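(* There is a polynomial-time algorithm that, given $C,C'\in\mathcal{L}(\geq,\sqcap,\top)$, decides whether $\models C\sqsubseteq C'$.
   Context: $\mathcal{L}(\geq,\sqcap,\top)$ is the set of concepts $C ::= A\mid\top\mid C\sqcap C\mid (\geq k\,R.C)$ with $A$ a concept name, $R$ a role name, $k\ge 1$ (numbers written in binary), interpreted in the standard way: $(\geq k\,R.C)^{\mathcal I}$ is the set of elements with at least $k$ pairwise distinct $R$-successors in $C^{\mathcal I}$. $\models C\sqsubseteq C'$ means $C^{\mathcal I}\subseteq C'^{\mathcal I}$ in every interpretation $\mathcal I$. Running time is measured in $|C|+|C'|$, the number of symbols. *)

theory Defs
  imports "HOL-Computational_Algebra.Polynomial" "HOL-Library.Countable_Set"
begin

section \<open>Syntax and semantics\<close>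

text \<open>Concept names and role names are the members of two countably infinite sets, indexed by binary
  words.  Number restrictions use the type \<^typ>\<open>num\<close> of binary numerals, whose values are
  exactly the integers \<open>k \<ge> 1\<close>.\<close>

type_synonym name = "bool list"

datatype concept =
    Atom name
  | Top
  | And concept concept
  | AtLeast num name concept

record 'd interp =
  domain :: "'d set"
  conc :: "name \<Rightarrow> 'd set"
  role :: "name \<Rightarrow> ('d \<times> 'd) set"

definition is_interp :: "'d interp \<Rightarrow> bool" where
  "is_interp I \<longleftrightarrow> domain I \<noteq> {} \<and> (\<forall>A. conc I A \<subseteq> domain I) \<and>
     (\<forall>R. role I R \<subseteq> domain I \<times> domain I)"

primrec extension :: "'d interp \<Rightarrow> concept \<Rightarrow> 'd set" where
  "extension I (Atom A) = conc I A"
| "extension I Top = domain I"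
| "extension I (And C D) = extension I C \<inter> extension I D"
| "extension I (AtLeast k R C) =
     {x \<in> domain I. \<exists>S. S \<subseteq> {y. (x, y) \<in> role I R \<and> y \<in> extension I C} \<and> finite S \<and> card S = numeral k}"

text \<open>A formula cannot quantify over all types, so the domains range over the nonempty sets of
  natural numbers.  This is no restriction: by \<open>subsumed_iff\<close> below, interpretations over any
  other infinite type give the same relation, and by \<open>subsumed_extension\<close> a subsumption that holds
  here holds in the interpretations over every type.\<close>

definition subsumed :: "concept \<Rightarrow> concept \<Rightarrow> bool" where
  "subsumed C D \<longleftrightarrow> (\<forall>I :: nat interp. is_interp I \<longrightarrow> extension I C \<subseteq> extension I D)"

instance num :: countable by countable_datatype
instance concept :: countable by countable_datatype

lemma extension_transfer:
  fixes I :: "'d interp" and f :: "'d \<Rightarrow> 'e"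
  assumes I: "is_interp I" and S: "S \<subseteq> domain I" and inj: "inj_on f S"
    and closed: "\<And>x k R C. x \<in> S \<Longrightarrow> x \<in> extension I (AtLeast k R C) \<Longrightarrow>
      \<exists>T\<subseteq>S. T \<subseteq> {y. (x, y) \<in> role I R \<and> y \<in> extension I C} \<and> finite T \<and> card T = numeral k"
  defines "J \<equiv> \<lparr>domain = f ` S, conc = (\<lambda>A. f ` (conc I A \<inter> S)),
                role = (\<lambda>R. map_prod f f ` (role I R \<inter> S \<times> S))\<rparr>"
  shows "extension J C = f ` (extension I C \<inter> S)"
proof (induction C)
  case (Atom A)
  show ?case by (simp add: J_def)
next
  case Top
  show ?case using S by (simp add: J_def Int_absorb1)
next
  case (And C D)
  have "f ` (extension I C \<inter> S) \<inter> f ` (extension I D \<inter> S)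
      = f ` ((extension I C \<inter> S) \<inter> (extension I D \<inter> S))"
    using inj_on_image_Int[OF inj, of "extension I C \<inter> S" "extension I D \<inter> S"] by simp
  then show ?case using And by (simp add: Int_ac)
next
  case (AtLeast k R C)
  have succ: "{z. (f x, z) \<in> role J R \<and> z \<in> extension J C} =
      f ` ({y. (x, y) \<in> role I R \<and> y \<in> extension I C} \<inter> S)" if "x \<in> S" for x
  proof -
    have role: "(f x, z) \<in> role J R \<longleftrightarrow> (\<exists>y\<in>S. z = f y \<and> (x, y) \<in> role I R)" for z
    proof
      assume "(f x, z) \<in> role J R"
      then obtain u v where uv: "(u, v) \<in> role I R" "u \<in> S" "v \<in> S" "f x = f u" "z = f v"
        by (auto simp: J_def)
      then have "u = x" using inj_onD[OF inj] that by metis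
      then show "\<exists>y\<in>S. z = f y \<and> (x, y) \<in> role I R" using uv by blast
    next
      assume "\<exists>y\<in>S. z = f y \<and> (x, y) \<in> role I R"
      then obtain y where y: "y \<in> S" "z = f y" "(x, y) \<in> role I R" by blast
      then have "(x, y) \<in> role I R \<inter> S \<times> S" using that by blast
      then have "map_prod f f (x, y) \<in> role J R" unfolding J_def by (simp only: interp.simps imageI)
      then show "(f x, z) \<in> role J R" using y by simp
    qed
    have ext: "f y \<in> extension J C \<longleftrightarrow> y \<in> extension I C" if "y \<in> S" for y
      using that inj_onD[OF inj] unfolding AtLeast by blast
    show ?thesis unfolding role using ext by blast
  qed
  have "f x \<in> extension J (AtLeast k R C) \<longleftrightarrow> x \<in> extension I (AtLeast k R C)" if x: "x \<in> S" for x
  proof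
    assume "f x \<in> extension J (AtLeast k R C)"
    then obtain T where T: "T \<subseteq> f ` ({y. (x, y) \<in> role I R \<and> y \<in> extension I C} \<inter> S)"
        "finite T" "card T = numeral k"
      using succ[OF x] by auto
    then obtain U where U: "U \<subseteq> {y. (x, y) \<in> role I R \<and> y \<in> extension I C} \<inter> S" "T = f ` U"
      by (auto simp: subset_image_iff)
    have "inj_on f U" using U inj by (meson inj_on_subset le_infE)
    then have "finite U" "card U = numeral k"
      using T U by (auto simp: finite_image_iff card_image)
    then show "x \<in> extension I (AtLeast k R C)" using U x S by auto
  next
    assume "x \<in> extension I (AtLeast k R C)"
    then obtain T where T: "T \<subseteq> S" "T \<subseteq> {y. (x, y) \<in> role I R \<and> y \<in> extension I C}"
        "finite T" "card T = numeral k"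
      using closed[OF x, of k R C] by blast
    have "card (f ` T) = numeral k" using T inj by (metis card_image inj_on_subset)
    moreover have "f ` T \<subseteq> {z. (f x, z) \<in> role J R \<and> z \<in> extension J C}"
      unfolding succ[OF x] using T by blast
    moreover have "f x \<in> domain J" using x by (simp add: J_def)
    ultimately show "f x \<in> extension J (AtLeast k R C)"
      unfolding extension.simps mem_Collect_eq using finite_imageI[OF T(3), of f] by blast
  qed
  moreover have "extension J (AtLeast k R C) \<subseteq> f ` S" by (auto simp: J_def)
  ultimately show ?case by blast
qed

lemma extension_subset_domain: "is_interp I \<Longrightarrow> extension I C \<subseteq> domain I"
  by (induction C) (auto simp: is_interp_def)

lemma subsumed_extension:
  fixes I :: "'d interp"
  assumes sub: "subsumed C D" and I: "is_interp I"
  shows "extension I C \<subseteq> extension I D"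
proof
  fix x assume xC: "x \<in> extension I C"
  define W where "W = (\<lambda>y (k, R, E). if y \<in> extension I (AtLeast k R E) then
      (SOME T. T \<subseteq> {z. (y, z) \<in> role I R \<and> z \<in> extension I E} \<and> finite T \<and> card T = numeral k) else {})"
  have W: "W y (k, R, E) \<subseteq> {z. (y, z) \<in> role I R \<and> z \<in> extension I E} \<and> finite (W y (k, R, E)) \<and>
      card (W y (k, R, E)) = numeral k" if "y \<in> extension I (AtLeast k R E)" for y k R E
  proof -
    have "\<exists>T. T \<subseteq> {z. (y, z) \<in> role I R \<and> z \<in> extension I E} \<and> finite T \<and> card T = numeral k"
      using that by simp
    from someI_ex[OF this] show ?thesis using that unfolding W_def by (simp only: prod.case if_True)
  qed
  have Wfin: "finite (W y t) \<and> W y t \<subseteq> domain I" for y t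
  proof (cases t)
    case (fields k R E)
    show ?thesis
    proof (cases "y \<in> extension I (AtLeast k R E)")
      case True
      then show ?thesis using W[OF True] fields extension_subset_domain[OF I, of E] by blast
    next
      case False
      then show ?thesis using fields by (simp add: W_def del: extension.simps)
    qed
  qed
  define F where "F = (\<lambda>n. ((\<lambda>X. \<Union>y\<in>X. \<Union>t. W y t) ^^ n) {x})"
  define S where "S = (\<Union>n. F n)"
  have FS: "F (Suc n) = (\<Union>y\<in>F n. \<Union>t. W y t)" for n by (simp add: F_def)
  have "countable (F n) \<and> F n \<subseteq> domain I" for n
  proof (induction n)
    case 0
    show ?case using xC extension_subset_domain[OF I] by (auto simp: F_def)
  next
    case (Suc n)
    then have "countable (F (Suc n))"
      using Wfin unfolding FS by (intro countable_UN) (simp_all add: countable_finite)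
    moreover have "F (Suc n) \<subseteq> domain I" using Wfin unfolding FS by blast
    ultimately show ?case by blast
  qed
  then have S: "countable S" "S \<subseteq> domain I" by (auto simp: S_def)
  have xS: "x \<in> S" unfolding S_def F_def by (rule UN_I[of 0]) auto
  have SW: "W y t \<subseteq> S" if yS: "y \<in> S" for y t
  proof -
    obtain n where "y \<in> F n" using yS by (auto simp: S_def)
    then have "W y t \<subseteq> F (Suc n)" unfolding FS by blast
    then show ?thesis by (auto simp: S_def)
  qed
  define f where "f = to_nat_on S"
  have inj: "inj_on f S" unfolding f_def using S(1) by (rule inj_on_to_nat_on)
  define J where "J = \<lparr>domain = f ` S, conc = (\<lambda>A. f ` (conc I A \<inter> S)),
                role = (\<lambda>R. map_prod f f ` (role I R \<inter> S \<times> S))\<rparr>"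
  have eq: "extension J E = f ` (extension I E \<inter> S)" for E
    unfolding J_def
  proof (rule extension_transfer[OF I S(2) inj])
    fix y k R E assume "y \<in> S" "y \<in> extension I (AtLeast k R E)"
    then show "\<exists>T\<subseteq>S. T \<subseteq> {z. (y, z) \<in> role I R \<and> z \<in> extension I E} \<and> finite T \<and> card T = numeral k"
      using SW[of y "(k, R, E)"] W[of y k R E] by blast
  qed
  have "is_interp J" using xS by (auto simp: is_interp_def J_def)
  then have "extension J C \<subseteq> extension J D" using sub by (simp add: subsumed_def)
  then have "f x \<in> f ` (extension I D \<inter> S)" using xC xS unfolding eq by blast
  then show "x \<in> extension I D" using inj xS by (auto simp: inj_on_eq_iff)
qed

lemma subsumed_iff:
  assumes inf: "infinite (UNIV :: 'd set)"
  shows "subsumed C D \<longleftrightarrow> (\<forall>I :: 'd interp. is_interp I \<longrightarrow> extension I C \<subseteq> extension I D)"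
proof
  assume "subsumed C D"
  then show "\<forall>I :: 'd interp. is_interp I \<longrightarrow> extension I C \<subseteq> extension I D"
    using subsumed_extension by blast
next
  assume R: "\<forall>I :: 'd interp. is_interp I \<longrightarrow> extension I C \<subseteq> extension I D"
  obtain f :: "nat \<Rightarrow> 'd" where f: "inj f" using inf by (meson infinite_countable_subset)
  show "subsumed C D"
    unfolding subsumed_def
  proof (intro allI impI)
    fix I :: "nat interp" assume I: "is_interp I"
    define S where "S = domain I"
    define J where "J = \<lparr>domain = f ` S, conc = (\<lambda>A. f ` (conc I A \<inter> S)),
                role = (\<lambda>R. map_prod f f ` (role I R \<inter> S \<times> S))\<rparr>"
    have inj: "inj_on f S" using f by (meson inj_on_subset subset_UNIV)
    have eq: "extension J E = f ` (extension I E \<inter> S)" for E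
      unfolding J_def
    proof (rule extension_transfer[OF I _ inj])
      show "S \<subseteq> domain I" by (simp add: S_def)
      fix y k R E assume "y \<in> S" "y \<in> extension I (AtLeast k R E)"
      then obtain T where T: "T \<subseteq> {z. (y, z) \<in> role I R \<and> z \<in> extension I E}" "finite T" "card T = numeral k"
        by auto
      moreover have "T \<subseteq> S" using T(1) extension_subset_domain[OF I, of E] by (auto simp: S_def)
      ultimately show "\<exists>T\<subseteq>S. T \<subseteq> {z. (y, z) \<in> role I R \<and> z \<in> extension I E} \<and> finite T \<and> card T = numeral k"
        by blast
    qed
    have "is_interp J" using I by (auto simp: is_interp_def J_def S_def)
    then have "extension J C \<subseteq> extension J D" using R by blast
    then have "extension I C \<inter> S \<subseteq> extension I D \<inter> S"
      unfolding eq using inj_image_subset_iff[OF f] by simp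
    then show "extension I C \<subseteq> extension I D"
      using extension_subset_domain[OF I, of C] by (auto simp: S_def)
  qed
qed


section \<open>Concepts as words\<close>

text \<open>A concept is written over a finite alphabet as \<open>A\<^bsub>w\<^esub>\<close>, \<open>\<top>\<close>, \<open>(C \<sqinter> D)\<close> or \<open>(\<ge> k R\<^bsub>w\<^esub>. C)\<close>,
  with \<open>w\<close> and \<open>k\<close> in binary.\<close>

datatype letter = Dig bool | LConc | LRole | LTop | LAnd | LGeq | LDot | LOpen | LClose | LSub

text \<open>Most significant digit first.\<close>

primrec digits :: "num \<Rightarrow> bool list" where
  "digits num.One = [True]"
| "digits (num.Bit0 k) = digits k @ [False]"
| "digits (num.Bit1 k) = digits k @ [True]"

primrec word_of :: "concept \<Rightarrow> letter list" where
  "word_of (Atom A) = LConc # map Dig A"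
| "word_of Top = [LTop]"
| "word_of (And C D) = [LOpen] @ word_of C @ [LAnd] @ word_of D @ [LClose]"
| "word_of (AtLeast k R C) =
     [LOpen, LGeq] @ map Dig (digits k) @ [LRole] @ map Dig R @ [LDot] @ word_of C @ [LClose]"

definition csize :: "concept \<Rightarrow> nat" where
  "csize C = length (word_of C)"

definition input_word :: "concept \<Rightarrow> concept \<Rightarrow> letter list" where
  "input_word C D = word_of C @ [LSub] @ word_of D"


section \<open>Deterministic multi-tape Turing machines\<close>

datatype 'a cell = Blank | Input 'a | Work nat

datatype move = MLeft | MStay | MRight

record 'a tm =
  tapes :: nat
  states :: "nat set"
  alphabet :: "'a cell set"
  start :: nat
  accept :: nat
  reject :: nat
  delta :: "nat \<Rightarrow> 'a cell list \<Rightarrow> nat \<times> ('a cell \<times> move) list"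

definition turing_machine :: "'a tm \<Rightarrow> bool" where
  "turing_machine M \<longleftrightarrow>
     tapes M \<ge> 1 \<and> finite (states M) \<and> finite (alphabet M) \<and>
     {start M, accept M, reject M} \<subseteq> states M \<and> accept M \<noteq> reject M \<and>
     Blank \<in> alphabet M \<and> range Input \<subseteq> alphabet M \<and>
     (\<forall>q\<in>states M. \<forall>cs. length cs = tapes M \<and> set cs \<subseteq> alphabet M \<longrightarrow>
        (case delta M q cs of (q', as) \<Rightarrow>
           q' \<in> states M \<and> length as = tapes M \<and> fst ` set as \<subseteq> alphabet M))"

text \<open>Tapes are infinite in both directions; the second component is the head position.\<close>

type_synonym 'a tape = "(int \<Rightarrow> 'a cell) \<times> int"

type_synonym 'a config = "nat \<times> 'a tape list"

fun scanned :: "'a tape \<Rightarrow> 'a cell" where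
  "scanned (t, h) = t h"

fun shift :: "move \<Rightarrow> int \<Rightarrow> int" where
  "shift MLeft h = h - 1"
| "shift MStay h = h"
| "shift MRight h = h + 1"

fun act :: "'a cell \<times> move \<Rightarrow> 'a tape \<Rightarrow> 'a tape" where
  "act (c, m) (t, h) = (t(h := c), shift m h)"

fun step :: "'a tm \<Rightarrow> 'a config \<Rightarrow> 'a config" where
  "step M (q, ts) =
     (if q = accept M \<or> q = reject M then (q, ts)
      else case delta M q (map scanned ts) of (q', as) \<Rightarrow> (q', map2 act as ts))"

definition input_tape :: "'a list \<Rightarrow> 'a tape" where
  "input_tape w = ((\<lambda>i. if 0 \<le> i \<and> i < int (length w) then Input (w ! nat i) else Blank), 0)"

definition initial :: "'a tm \<Rightarrow> 'a list \<Rightarrow> 'a config" where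
  "initial M w = (start M, input_tape w # replicate (tapes M - 1) (input_tape []))"

definition accepts_within :: "'a tm \<Rightarrow> 'a list \<Rightarrow> nat \<Rightarrow> bool" where
  "accepts_within M w n \<longleftrightarrow> (\<exists>t\<le>n. fst ((step M ^^ t) (initial M w)) = accept M)"

definition rejects_within :: "'a tm \<Rightarrow> 'a list \<Rightarrow> nat \<Rightarrow> bool" where
  "rejects_within M w n \<longleftrightarrow> (\<exists>t\<le>n. fst ((step M ^^ t) (initial M w)) = reject M)"

end

theory Submission imports Defs begin

text \<open>\<open>C \<sqsubseteq> D\<close> holds iff every conjunct of \<open>D\<close> is matched by a single conjunct of \<open>C\<close>: a name by the
  same name, and \<open>\<ge> k R. D'\<close> by some \<open>\<ge> l R. C'\<close> with \<open>k \<le> l\<close> and \<open>C' \<sqsubseteq> D'\<close>.  Restrictions of \<open>C\<close> do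
  not add up, because successors required by different conjuncts may be shared; one universal
  interpretation, whose elements each refute a single conjunct and are otherwise as permissive as
  possible, contains all counterexamples.

  This recursion visits each pair of subconcept occurrences at most once.  Since the word of a concept
  determines the parent and the siblings of each occurrence, a machine with one head on each concept
  needs no recursion stack: it walks through the pairs, using a unary counter to match parentheses, so
  that every visit takes linear time and the whole run takes cubic time.\<close>

section \<open>Structural characterisation of subsumption\<close>

primrec atoms :: "concept \<Rightarrow> name set" where
  "atoms (Atom A) = {A}"
| "atoms Top = {}"
| "atoms (And C D) = atoms C \<union> atoms D"
| "atoms (AtLeast k R C) = {}"

primrec restrictions :: "concept \<Rightarrow> (num \<times> name \<times> concept) set" where
  "restrictions (Atom A) = {}"
| "restrictions Top = {}"
| "restrictions (And C D) = restrictions C \<union> restrictions D"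
| "restrictions (AtLeast k R C) = {(k, R, C)}"

primrec covers :: "concept \<Rightarrow> concept \<Rightarrow> bool" where
  "covers (Atom A) C \<longleftrightarrow> A \<in> atoms C"
| "covers Top C \<longleftrightarrow> True"
| "covers (And D E) C \<longleftrightarrow> covers D C \<and> covers E C"
| "covers (AtLeast k R D) C \<longleftrightarrow> (\<exists>(l, S, E) \<in> restrictions C. S = R \<and> k \<le> l \<and> covers D E)"

text \<open>\<open>Top\<close> contributes nothing: no element can refute it, so no countermodel
  element is indexed by it.\<close>

primrec conjuncts :: "concept \<Rightarrow> concept set" where
  "conjuncts (Atom A) = {Atom A}"
| "conjuncts Top = {}"
| "conjuncts (And C D) = conjuncts C \<union> conjuncts D"
| "conjuncts (AtLeast k R C) = {AtLeast k R C}"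

lemma covers_conjuncts: "covers D C \<longleftrightarrow> (\<forall>e\<in>conjuncts D. covers e C)"
  by (induction D) auto

lemma extension_atoms: "x \<in> extension I C \<Longrightarrow> A \<in> atoms C \<Longrightarrow> x \<in> conc I A"
  by (induction C) auto

lemma extension_restrictions:
  "x \<in> extension I C \<Longrightarrow> (k, R, E) \<in> restrictions C \<Longrightarrow> x \<in> extension I (AtLeast k R E)"
  by (induction C) auto

text \<open>For a restriction, a witness set of \<open>l\<close> successors in \<open>E\<close>
  shrinks to one of size \<open>k\<close>, and the induction hypothesis moves its members from
  \<open>E\<close> to \<open>D\<close>.\<close>

lemma covers_sound:
  assumes I: "is_interp I"
  shows "covers D C \<Longrightarrow> x \<in> extension I C \<Longrightarrow> x \<in> extension I D"
proof (induction D arbitrary: C x)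
  case (Atom A)
  then show ?case by (simp add: extension_atoms)
next
  case Top
  then show ?case using extension_subset_domain[OF I] by auto
next
  case (And D E)
  then show ?case by auto
next
  case (AtLeast k R D)
  then obtain l E where lE: "(l, R, E) \<in> restrictions C" "k \<le> l" "covers D E" by auto
  from extension_restrictions[OF AtLeast.prems(2) lE(1)]
  obtain S where S: "S \<subseteq> {y. (x, y) \<in> role I R \<and> y \<in> extension I E}" "finite S"
      "card S = numeral l" and x: "x \<in> domain I" by auto
  have "numeral k \<le> card S" using lE(2) S(3) by simp
  then obtain T where T: "T \<subseteq> S" "card T = numeral k" "finite T"
    using obtain_subset_with_card_n by metis
  have "T \<subseteq> {y. (x, y) \<in> role I R \<and> y \<in> extension I D}"
    using T(1) S(1) AtLeast.IH[OF lE(3)] by blast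
  then show ?case using T x by auto
qed

section \<open>The universal countermodel and completeness\<close>

text \<open>The element \<open>(Some e, n)\<close> is the most permissive element outside the extension of \<open>e\<close>, and
  \<open>(None, n)\<close> lies in every extension; \<open>n\<close> only provides infinitely many copies.\<close>

fun refuter_succ :: "concept option \<times> nat \<Rightarrow> name \<Rightarrow> (concept option \<times> nat) set" where
  "refuter_succ (Some (AtLeast k R D), n) S =
     (if S = R then {(None, m) |m. Suc m < numeral k} \<union> {(Some e, m) |e m. e \<in> conjuncts D} else UNIV)"
| "refuter_succ _ S = UNIV"

definition refuter_model :: "(concept option \<times> nat) interp" where
  "refuter_model = \<lparr>domain = UNIV, conc = (\<lambda>A. {x. fst x \<noteq> Some (Atom A)}),
     role = (\<lambda>S. {(x, y). y \<in> refuter_succ x S})\<rparr>"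

lemma refuter_model_simps [simp]:
  "domain refuter_model = UNIV"
  "x \<in> conc refuter_model A \<longleftrightarrow> fst x \<noteq> Some (Atom A)"
  "(x, y) \<in> role refuter_model S \<longleftrightarrow> y \<in> refuter_succ x S"
  by (simp_all add: refuter_model_def)

lemma is_interp_refuter_model: "is_interp refuter_model"
  by (simp add: is_interp_def refuter_model_def)

lemma None_in_extension: "(None, n) \<in> extension refuter_model C"
proof (induction C arbitrary: n)
  case (AtLeast k R C)
  have "Pair None ` {..<numeral k :: nat} \<subseteq> {y. y \<in> extension refuter_model C}"
    using AtLeast by auto
  moreover have "card (Pair (None :: concept option) ` {..<numeral k :: nat}) = numeral k"
    by (simp add: card_image inj_on_def)
  ultimately show ?case by auto
qed auto

text \<open>In the restriction case, the successors \<open>(Some e, m)\<close> with \<open>e\<close>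
  a conjunct of the body are excluded by induction, so only the \<open>k - 1\<close> copies of
  \<open>None\<close> can count, one too few.\<close>

lemma refuter_not_in_extension: "e \<in> conjuncts D \<Longrightarrow> (Some e, n) \<notin> extension refuter_model D"
proof (induction D arbitrary: e n)
  case (AtLeast k R D)
  have "card T < numeral k"
    if T: "T \<subseteq> {y. y \<in> refuter_succ (Some (AtLeast k R D), n) R \<and> y \<in> extension refuter_model D}" for T
  proof -
    have "T \<subseteq> Pair None ` {..<numeral k - 1}"
    proof
      fix y assume "y \<in> T"
      then have "y \<in> refuter_succ (Some (AtLeast k R D), n) R" "y \<in> extension refuter_model D"
        using T by auto
      then show "y \<in> Pair None ` {..<numeral k - 1}" using AtLeast.IH by auto
    qed
    then have "card T \<le> card (Pair (None :: concept option) ` {..<numeral k - 1 :: nat})"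
      by (intro card_mono) auto
    also have "\<dots> = numeral k - 1" by (simp add: card_image inj_on_def)
    also have "\<dots> < (numeral k :: nat)" by (simp add: numeral_eq_Suc)
    finally show ?thesis .
  qed
  note small = this
  show ?case
  proof
    assume "(Some e, n) \<in> extension refuter_model (AtLeast k R D)"
    then obtain T where "T \<subseteq> {y. y \<in> refuter_succ (Some (AtLeast k R D), n) R \<and> y \<in> extension refuter_model D}"
        "card T = numeral k"
      using AtLeast.prems by (auto simp del: refuter_succ.simps)
    then show False using small[of T] by simp
  qed
qed auto

text \<open>\<open>D\<close> serves to make \<open>e\<close> a single conjunct. The \<open>l\<close>
  witnesses for a restriction on \<open>S\<close> have three sources. If \<open>e\<close> is not a
  restriction on \<open>S\<close>, every element is a successor and copies of \<open>None\<close>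
  suffice. If the body of \<open>e\<close> covers \<open>E\<close>, failure of covering forces
  \<open>l < k\<close>, so the \<open>k - 1\<close> copies of \<open>None\<close> suffice. Otherwise
  some conjunct of the body does not cover \<open>E\<close>, and its refuter has unlimited
  copies.\<close>

lemma refuter_in_extension:
  "e \<in> conjuncts D \<Longrightarrow> \<not> covers e C \<Longrightarrow> (Some e, n) \<in> extension refuter_model C"
proof (induction C arbitrary: e D n)
  case (Atom A)
  then show ?case by auto
next
  case Top
  then show ?case by simp
next
  case (And C1 C2)
  \<comment> \<open>A single conjunct covers a conjunction exactly when it covers one side; this
    would fail for \<open>e\<close> a conjunction, whose two parts may be matched on different
    sides.\<close>
  have "\<not> covers e C1 \<and> \<not> covers e C2"
  proof -
    have "conjuncts e = {e} \<and> (\<forall>C D. e \<noteq> And C D) \<and> e \<noteq> Top"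
      using And.prems(1) by (induction D) auto
    then show ?thesis using And.prems(2) by (cases e) auto
  qed
  then show ?case using And by auto
next
  case (AtLeast l S E)
  let ?X = "{y. y \<in> refuter_succ (Some e, n) S \<and> y \<in> extension refuter_model E}"
  obtain f where f: "Pair f ` {..<numeral l :: nat} \<subseteq> ?X"
  proof (cases "\<exists>k D'. e = AtLeast k S D'")
    case False
    then have "refuter_succ (Some e, n) S = UNIV" by (cases e) auto
    then show ?thesis using None_in_extension that[of None] by auto
  next
    case True
    then obtain k D' where e: "e = AtLeast k S D'" by blast
    show ?thesis
    proof (cases "covers D' E")
      case True
      then have "(numeral l :: nat) < numeral k" using AtLeast.prems(2) e by auto
      \<comment> \<open>The available copies of \<open>None\<close> are those with
        \<open>Suc m < numeral k\<close>, hence the bound by the predecessor of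
        \<open>k\<close>.\<close>
      then have "(numeral l :: nat) \<le> pred_numeral k" by (simp add: numeral_eq_Suc)
      then have "Pair None ` {..<numeral l} \<subseteq> ?X" using e None_in_extension by auto
      then show ?thesis by (rule that)
    next
      case False
      then obtain e' where "e' \<in> conjuncts D'" "\<not> covers e' E" using covers_conjuncts by blast
      then show ?thesis using that[of "Some e'"] e AtLeast.IH by auto
    qed
  qed
  moreover have "card (Pair f ` {..<numeral l :: nat}) = numeral l"
    by (simp add: card_image inj_on_def)
  ultimately show ?case by auto
qed

text \<open>An uncovered conjunct \<open>e\<close> of \<open>D\<close> makes
  \<open>(Some e, n)\<close> a member of \<open>C\<close> outside \<open>D\<close>.
  \<open>subsumed_extension\<close> carries the subsumption from domains of natural numbers to the
  domain of \<open>refuter_model\<close>.\<close>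

lemma subsumed_iff_covers: "subsumed C D \<longleftrightarrow> covers D C"
proof
  assume "subsumed C D"
  then have sub: "extension refuter_model C \<subseteq> extension refuter_model D"
    by (rule subsumed_extension[OF _ is_interp_refuter_model])
  show "covers D C"
  proof (rule ccontr)
    assume "\<not> covers D C"
    then obtain e where "e \<in> conjuncts D" "\<not> covers e C" using covers_conjuncts by blast
    then show False using sub refuter_in_extension refuter_not_in_extension by blast
  qed
next
  assume "covers D C"
  then show "subsumed C D" unfolding subsumed_def by (intro allI impI subsetI) (rule covers_sound)
qed


section \<open>The Turing machine\<close>

text \<open>\<open>Eval\<close> starts a visit with both heads on first letters of nodes and first
  decomposes \<open>D\<close>; \<open>EvalC g\<close> decomposes \<open>C\<close> once the node of
  \<open>D\<close> is a restriction (\<open>g\<close>) or a name (\<open>\<not> g\<close>).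
  \<open>Cmp\<close> states compare headers, with \<open>CmpName True\<close> for role names;
  \<open>Back\<close> states return from inside a header to its first letter. \<open>RetC b\<close>
  reports the result \<open>b\<close> for the node of \<open>C\<close>, \<open>RetD b\<close> for
  the node of \<open>D\<close>. From there \<open>Sib\<close> moves from a left conjunct to its
  right sibling, and \<open>Par\<close> from a right conjunct to the parent.\<close>

datatype control =
    Start | Copy | Rewind
  | Eval | EvalOpen | EvalC bool | EvalCOpen bool
  | CmpStart | CmpNum "bool option" | CmpName bool
  | BackC bool | BackD bool
  | RetC bool | RetCLeft bool | SibC | ParC bool
  | RetD bool | RetDLeft bool | SibD | ParD bool
  | Accept | Reject

instance control :: countable by countable_datatype

lemma finite_control: "finite (UNIV :: control set)"
proof -
  have "UNIV \<subseteq> {Start, Copy, Rewind, Eval, EvalOpen, CmpStart, SibC, SibD, Accept, Reject} \<union>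
      range EvalC \<union> range EvalCOpen \<union> range CmpNum \<union> range CmpName \<union> range BackC \<union> range BackD \<union>
      range RetC \<union> range RetCLeft \<union> range ParC \<union> range RetD \<union> range RetDLeft \<union> range ParD"
  proof
    fix s :: control
    show "s \<in> {Start, Copy, Rewind, Eval, EvalOpen, CmpStart, SibC, SibD, Accept, Reject} \<union>
      range EvalC \<union> range EvalCOpen \<union> range CmpNum \<union> range CmpName \<union> range BackC \<union> range BackD \<union>
      range RetC \<union> range RetCLeft \<union> range ParC \<union> range RetD \<union> range RetDLeft \<union> range ParD"
      by (cases s) simp_all
  qed
  then show ?thesis by (rule finite_subset) simp
qed

lemma finite_letter: "finite (UNIV :: letter set)"
proof -
  have "UNIV \<subseteq> range Dig \<union> {LConc, LRole, LTop, LAnd, LGeq, LDot, LOpen, LClose, LSub}"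
  proof
    fix a :: letter
    show "a \<in> range Dig \<union> {LConc, LRole, LTop, LAnd, LGeq, LDot, LOpen, LClose, LSub}"
      by (cases a) simp_all
  qed
  then show ?thesis by (rule finite_subset) simp
qed

definition is_digit :: "letter cell \<Rightarrow> bool" where
  "is_digit x \<longleftrightarrow> (\<exists>b. x = Input (Dig b))"

text \<open>The scanned cells are \<open>x\<close> on the input tape (where the head walks through the right-hand
  concept \<open>D\<close>), \<open>y\<close> on the copy of the left-hand concept \<open>C\<close>, and \<open>z\<close> on the counter tape, whose
  only nonblank cell is the origin.  A node of a concept is addressed by the position of its first
  letter; the letter to the left of that position shows whether the node is the root
  (\<open>LSub\<close> or blank), a left conjunct (\<open>LOpen\<close>), a right conjunct (\<open>LAnd\<close>) or the body of a
  restriction (\<open>LDot\<close>).\<close>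

primrec transition :: "control \<Rightarrow> letter cell \<Rightarrow> letter cell \<Rightarrow> letter cell \<Rightarrow> control \<times> move \<times> move \<times> move" where
  "transition Start x y z = (Copy, MStay, MStay, MStay)"
| "transition Copy x y z =
     (if x = Input LSub then (Rewind, MRight, MLeft, MStay) else (Copy, MRight, MRight, MStay))"
| "transition Rewind x y z =
     (if y = Blank then (Eval, MStay, MRight, MStay) else (Rewind, MStay, MLeft, MStay))"
| "transition Eval x y z =
     (if x = Input LTop then (RetC True, MStay, MStay, MStay)
      else if x = Input LOpen then (EvalOpen, MRight, MStay, MStay)
      else (EvalC False, MStay, MStay, MStay))"
| "transition EvalOpen x y z =
     (if x = Input LGeq then (EvalC True, MLeft, MStay, MStay) else (Eval, MStay, MStay, MStay))"
| "transition (EvalC g) x y z =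
     (if y = Input LTop then (RetC False, MStay, MStay, MStay)
      else if y = Input LOpen then (EvalCOpen g, MStay, MRight, MStay)
      else if g then (RetC False, MStay, MStay, MStay)
      else (CmpName False, MRight, MRight, MStay))"
| "transition (EvalCOpen g) x y z =
     (if y = Input LGeq then
        if g then (CmpStart, MRight, MStay, MStay) else (RetC False, MStay, MLeft, MStay)
      else (EvalC g, MStay, MStay, MStay))"
| "transition CmpStart x y z = (CmpNum None, MRight, MRight, MStay)"
| "transition (CmpNum c) x y z =
     (if y = Input LRole then
        if x = Input LRole \<and> c \<noteq> Some False then (CmpName True, MRight, MRight, MStay)
        else (BackC False, MStay, MStay, MStay)
      else if x = Input LRole then (CmpNum (Some True), MStay, MRight, MStay)
      else (CmpNum (if c = None \<and> x \<noteq> y then Some (y = Input (Dig True)) else c), MRight, MRight, MStay))"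
| "transition (CmpName g) x y z =
     (if is_digit x \<and> x = y then (CmpName g, MRight, MRight, MStay)
      else if is_digit x \<or> is_digit y then (BackC False, MLeft, MLeft, MStay)
      else if g then (Eval, MRight, MRight, MStay)
      else (BackC True, MLeft, MLeft, MStay))"
| "transition (BackC b) x y z =
     (if y \<in> {Input LOpen, Input LConc} then (BackD b, MStay, MStay, MStay)
      else (BackC b, MStay, MLeft, MStay))"
| "transition (BackD b) x y z =
     (if x \<in> {Input LOpen, Input LConc} then (RetC b, MStay, MStay, MStay)
      else (BackD b, MLeft, MStay, MStay))"
| "transition (RetC b) x y z = (RetCLeft b, MStay, MLeft, MStay)"
| "transition (RetCLeft b) x y z =
     (if y = Input LOpen then
        if b then (RetC True, MStay, MStay, MStay) else (SibC, MStay, MRight, MStay)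
      else if y = Input LAnd then (ParC b, MStay, MLeft, MStay)
      else (RetD b, MStay, MRight, MStay))"
| "transition SibC x y z =
     (if y = Input LAnd \<and> z \<noteq> Blank then (Eval, MStay, MRight, MStay)
      else (SibC, MStay, MRight,
        if y = Input LOpen then MRight else if y = Input LClose then MLeft else MStay))"
| "transition (ParC b) x y z =
     (if y = Input LOpen \<and> z \<noteq> Blank then (RetC b, MStay, MStay, MStay)
      else (ParC b, MStay, MLeft,
        if y = Input LOpen then MLeft else if y = Input LClose then MRight else MStay))"
| "transition (RetD b) x y z = (RetDLeft b, MLeft, MStay, MStay)"
| "transition (RetDLeft b) x y z =
     (if x = Input LOpen then
        if b then (SibD, MRight, MStay, MStay) else (RetD False, MStay, MStay, MStay)
      else if x = Input LAnd then (ParD b, MLeft, MStay, MStay)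
      else if x = Input LDot then (BackC b, MStay, MLeft, MStay)
      else (if b then Accept else Reject, MStay, MStay, MStay))"
| "transition SibD x y z =
     (if x = Input LAnd \<and> z \<noteq> Blank then (Eval, MRight, MStay, MStay)
      else (SibD, MRight, MStay,
        if x = Input LOpen then MRight else if x = Input LClose then MLeft else MStay))"
| "transition (ParD b) x y z =
     (if x = Input LOpen \<and> z \<noteq> Blank then (RetD b, MStay, MStay, MStay)
      else (ParD b, MLeft, MStay,
        if x = Input LOpen then MLeft else if x = Input LClose then MRight else MStay))"
| "transition Accept x y z = (Accept, MStay, MStay, MStay)"
| "transition Reject x y z = (Reject, MStay, MStay, MStay)"

text \<open>Only \<open>Start\<close>, which marks the origin of the counter tape, and
  \<open>Copy\<close> can change a cell. All other states write back what they scan, so the later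
  analysis can keep the tape contents fixed and track head positions alone.\<close>

definition subsumption_tm :: "letter tm" where
  "subsumption_tm = \<lparr>tapes = 3, states = range (to_nat :: control \<Rightarrow> nat),
     alphabet = {Blank, Work 0} \<union> range Input,
     start = to_nat Start, accept = to_nat Accept, reject = to_nat Reject,
     delta = (\<lambda>q cs. case transition (from_nat q) (cs ! 0) (cs ! 1) (cs ! 2) of (s, m0, m1, m2) \<Rightarrow>
       (to_nat s,
        [(cs ! 0, m0),
         (if from_nat q = Copy \<and> cs ! 0 \<noteq> Input LSub then cs ! 0 else cs ! 1, m1),
         (if from_nat q = Start then Work 0 else cs ! 2, m2)]))\<rparr>"

lemma turing_machine_subsumption_tm: "turing_machine subsumption_tm"
proof -
  have delta: "case delta subsumption_tm q cs of (q', as) \<Rightarrow>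
      q' \<in> states subsumption_tm \<and> length as = tapes subsumption_tm \<and>
      fst ` set as \<subseteq> alphabet subsumption_tm"
    if "length cs = tapes subsumption_tm" and sub: "set cs \<subseteq> alphabet subsumption_tm" for q cs
  proof -
    have "length cs = Suc (Suc (Suc 0))" using that(1) by (simp add: subsumption_tm_def)
    then obtain x y z where "cs = [x, y, z]" by (auto simp: length_Suc_conv)
    then show ?thesis using sub by (auto simp: subsumption_tm_def split: prod.split)
  qed
  show ?thesis
    unfolding turing_machine_def
    by (intro conjI ballI allI impI delta)
      (auto simp: subsumption_tm_def finite_control finite_letter)
qed

section \<open>Bounded reachability and words on a tape\<close>

definition reach :: "nat \<Rightarrow> letter config \<Rightarrow> letter config \<Rightarrow> bool" where
  "reach n a b \<longleftrightarrow> (\<exists>m\<le>n. (step subsumption_tm ^^ m) a = b)"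

lemma reach_refl: "reach 0 a a"
  by (simp add: reach_def)

lemma reach_step: "step subsumption_tm a = b \<Longrightarrow> reach 1 a b"
  unfolding reach_def by (intro exI[of _ 1]) simp

lemma reach_trans [trans]: "reach m a b \<Longrightarrow> reach n b c \<Longrightarrow> reach (m + n) a c"
  unfolding reach_def
proof (elim exE conjE)
  fix p q assume "p \<le> m" "(step subsumption_tm ^^ p) a = b" "q \<le> n" "(step subsumption_tm ^^ q) b = c"
  then show "\<exists>r\<le>m + n. (step subsumption_tm ^^ r) a = c"
    by (intro exI[of _ "q + p"]) (simp add: funpow_add)
qed

lemma reach_mono: "reach m a b \<Longrightarrow> m \<le> n \<Longrightarrow> reach n a b"
  unfolding reach_def using le_trans by blast

lemma reach_cong: "reach m a b \<Longrightarrow> m \<le> n \<Longrightarrow> a = a' \<Longrightarrow> b = b' \<Longrightarrow> reach n a' b'"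
  using reach_mono by blast

definition origin_mark :: "int \<Rightarrow> letter cell" where
  "origin_mark = (\<lambda>_. Blank)(0 := Work 0)"

lemma origin_mark_Blank [simp]: "origin_mark k = Blank \<longleftrightarrow> k \<noteq> 0"
  by (simp add: origin_mark_def)

definition occ :: "(int \<Rightarrow> letter cell) \<Rightarrow> int \<Rightarrow> letter list \<Rightarrow> bool" where
  "occ T i u \<longleftrightarrow> (\<forall>m<length u. T (i + int m) = Input (u ! m))"

lemma occ_Nil [simp]: "occ T i []"
  by (simp add: occ_def)

lemma occ_Cons [simp]: "occ T i (a # u) \<longleftrightarrow> T i = Input a \<and> occ T (i + 1) u"
  by (auto simp: occ_def less_Suc_eq_0_disj algebra_simps)

lemma occ_append [simp]: "occ T i (u @ v) \<longleftrightarrow> occ T i u \<and> occ T (i + int (length u)) v"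
  by (induction u arbitrary: i) (auto simp: algebra_simps)

lemma csize_simps [simp]:
  "csize (Atom A) = Suc (length A)"
  "csize Top = 1"
  "csize (And C D) = csize C + csize D + 3"
  "csize (AtLeast k R C) = length (digits k) + length R + csize C + 5"
  by (simp_all add: csize_def)

lemma hd_word_of: "\<exists>a u. word_of C = a # u \<and> a \<in> {LConc, LTop, LOpen}"
  by (cases C) auto

lemma occ_word_of_hd:
  assumes "occ T i (word_of C)"
  shows "T i \<in> {Input LConc, Input LTop, Input LOpen}"
  using hd_word_of[of C] assms by auto

text \<open>The two scans are stated for an arbitrary family \<open>g\<close> of configurations, indexed by the head
  and counter positions, because they are used on both concept tapes.\<close>

lemma scan_right:
  fixes g :: "int \<Rightarrow> int \<Rightarrow> letter config"
  assumes step: "\<And>i k. T i = Input LOpen \<Longrightarrow> k \<ge> 0 \<Longrightarrow> reach 1 (g i k) (g (i + 1) (k + 1))"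
    "\<And>i k. T i = Input LClose \<Longrightarrow> k \<ge> 0 \<Longrightarrow> reach 1 (g i (k + 1)) (g (i + 1) k)"
    "\<And>i k. T i = Input LAnd \<Longrightarrow> k > 0 \<Longrightarrow> reach 1 (g i k) (g (i + 1) k)"
    "\<And>i k a. T i = Input a \<Longrightarrow> a \<notin> {LOpen, LClose, LAnd} \<Longrightarrow> k \<ge> 0 \<Longrightarrow> reach 1 (g i k) (g (i + 1) k)"
  shows "occ T i (word_of C) \<Longrightarrow> k \<ge> 0 \<Longrightarrow> reach (csize C) (g i k) (g (i + int (csize C)) k)"
proof -
  have flat: "reach (length u) (g i k) (g (i + int (length u)) k)"
    if "occ T i u" "set u \<inter> {LOpen, LClose, LAnd} = {}" "k \<ge> 0" for i k u
    using that
  proof (induction u arbitrary: i)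
    case (Cons a u)
    then have "reach 1 (g i k) (g (i + 1) k)" by (intro step(4)[of _ a]) auto
    also have "reach (length u) (g (i + 1) k) (g (i + 1 + int (length u)) k)"
      using Cons.prems by (intro Cons.IH) auto
    finally show ?case by (rule reach_cong) (simp_all add: algebra_simps)
  qed (simp add: reach_refl)
  show "occ T i (word_of C) \<Longrightarrow> k \<ge> 0 \<Longrightarrow> reach (csize C) (g i k) (g (i + int (csize C)) k)"
  proof (induction C arbitrary: i k)
    case (And C D)
    define c where "c = i + 1 + int (csize C)"
    define d where "d = c + 1 + int (csize D)"
    have o: "T i = Input LOpen" "occ T (i + 1) (word_of C)"
      "T c = Input LAnd" "occ T (c + 1) (word_of D)" "T d = Input LClose"
      using And.prems(1) by (simp_all add: c_def d_def csize_def)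
    \<comment> \<open>Between the outer parentheses the counter is positive, so the
      \<open>LAnd\<close> of this conjunction is passed over and does not end the scan.\<close>
    have k: "k + 1 \<ge> 0" "k + 1 > 0" using And.prems(2) by simp_all
    note step(1)[OF o(1) And.prems(2)]
    also note And.IH(1)[OF o(2) k(1), folded c_def]
    also note step(3)[OF o(3) k(2)]
    also note And.IH(2)[OF o(4) k(1), folded d_def]
    also note step(2)[OF o(5) And.prems(2)]
    finally show ?case by (rule reach_cong) (simp_all add: c_def d_def algebra_simps)
  next
    case (AtLeast n R C)
    define u where "u = LGeq # map Dig (digits n) @ [LRole] @ map Dig R @ [LDot]"
    define c where "c = i + 1 + int (length u)"
    define d where "d = c + int (csize C)"
    have o: "T i = Input LOpen" "occ T (i + 1) u" "occ T c (word_of C)" "T d = Input LClose"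
      using AtLeast.prems by (simp_all add: u_def c_def d_def csize_def add_ac)
    have u: "set u \<inter> {LOpen, LClose, LAnd} = {}" by (auto simp: u_def)
    have k: "k + 1 \<ge> 0" using AtLeast.prems(2) by simp
    note step(1)[OF o(1) AtLeast.prems(2)]
    also note flat[OF o(2) u k, folded c_def]
    also note AtLeast.IH[OF o(3) k, folded d_def]
    also note step(2)[OF o(4) AtLeast.prems(2)]
    finally show ?case by (rule reach_cong) (simp_all add: u_def c_def d_def algebra_simps)
  next
    case (Atom A)
    then show ?case using flat[of i "word_of (Atom A)" k] by (simp add: image_def)
  next
    case Top
    then show ?case using flat[of i "word_of Top" k] by simp
  qed
qed

lemma scan_left:
  fixes g :: "int \<Rightarrow> int \<Rightarrow> letter config"
  assumes step: "\<And>i k. T i = Input LClose \<Longrightarrow> k \<ge> 0 \<Longrightarrow> reach 1 (g i k) (g (i - 1) (k + 1))"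
    "\<And>i k. T i = Input LOpen \<Longrightarrow> k \<ge> 0 \<Longrightarrow> reach 1 (g i (k + 1)) (g (i - 1) k)"
    "\<And>i k a. T i = Input a \<Longrightarrow> a \<notin> {LOpen, LClose} \<Longrightarrow> k \<ge> 0 \<Longrightarrow> reach 1 (g i k) (g (i - 1) k)"
  shows "occ T (i + 1) (word_of C) \<Longrightarrow> k \<ge> 0 \<Longrightarrow> reach (csize C) (g (i + int (csize C)) k) (g i k)"
proof -
  have flat: "reach (length u) (g (i + int (length u)) k) (g i k)"
    if "occ T (i + 1) u" "set u \<inter> {LOpen, LClose} = {}" "k \<ge> 0" for i k u
    using that
  proof (induction u arbitrary: i)
    case (Cons a u)
    have "reach (length u) (g (i + 1 + int (length u)) k) (g (i + 1) k)"
      using Cons.prems by (intro Cons.IH) auto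
    also have "reach 1 \<dots> (g (i + 1 - 1) k)" using Cons.prems by (intro step(3)[of _ a]) auto
    finally show ?case by (rule reach_cong) (simp_all add: algebra_simps)
  qed (simp add: reach_refl)
  show "occ T (i + 1) (word_of C) \<Longrightarrow> k \<ge> 0 \<Longrightarrow> reach (csize C) (g (i + int (csize C)) k) (g i k)"
  proof (induction C arbitrary: i k)
    case (And C D)
    define c where "c = i + 1 + int (csize C)"
    define d where "d = c + 1 + int (csize D)"
    have o: "T (i + 1) = Input LOpen" "occ T (i + 1 + 1) (word_of C)"
      "T (c + 1) = Input LAnd" "occ T (c + 1 + 1) (word_of D)" "T (d + 1) = Input LClose"
      using And.prems(1) by (simp_all add: c_def d_def csize_def add_ac)
    have k: "k + 1 \<ge> 0" "k + 1 > 0" using And.prems(2) by simp_all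
    note step(1)[OF o(5) And.prems(2), simplified]
    also note And.IH(2)[OF o(4) k(1), folded d_def]
    also note step(3)[OF o(3) _ k(1), simplified]
    also note And.IH(1)[OF o(2) k(1), folded c_def]
    also note step(2)[OF o(1) And.prems(2), simplified]
    finally show ?case by (rule reach_cong) (simp_all add: c_def d_def algebra_simps)
  next
    case (AtLeast n R C)
    define u where "u = LGeq # map Dig (digits n) @ [LRole] @ map Dig R @ [LDot]"
    define c where "c = i + 1 + int (length u)"
    define d where "d = c + int (csize C)"
    have o: "T (i + 1) = Input LOpen" "occ T (i + 1 + 1) u" "occ T (c + 1) (word_of C)"
      "T (d + 1) = Input LClose"
      using AtLeast.prems by (simp_all add: u_def c_def d_def csize_def add_ac)
    have u: "set u \<inter> {LOpen, LClose} = {}" by (auto simp: u_def)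
    have k: "k + 1 \<ge> 0" using AtLeast.prems(2) by simp
    note step(1)[OF o(4) AtLeast.prems(2), simplified]
    also note AtLeast.IH[OF o(3) k, folded d_def]
    also note flat[OF o(2) u k, folded c_def]
    also note step(2)[OF o(1) AtLeast.prems(2), simplified]
    finally show ?case by (rule reach_cong) (simp_all add: u_def c_def d_def algebra_simps)
  next
    case (Atom A)
    then show ?case using flat[of i "word_of (Atom A)" k] by (simp add: image_def)
  next
    case Top
    then show ?case using flat[of i "word_of Top" k] by simp
  qed
qed


section \<open>Comparison of binary numerals\<close>

text \<open>This mirrors \<open>CmpNum\<close>, with the numeral of \<open>C\<close> first.
  \<open>c\<close> is \<open>None\<close> while the digits agree and afterwards holds the verdict of
  the first difference; a difference in length overrides it.\<close>

fun digits_ge :: "bool option \<Rightarrow> bool list \<Rightarrow> bool list \<Rightarrow> bool" where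
  "digits_ge c (a # u) (b # v) = digits_ge (if c = None \<and> a \<noteq> b then Some a else c) u v"
| "digits_ge c [] [] = (c \<noteq> Some False)"
| "digits_ge c (a # u) [] = True"
| "digits_ge c [] (b # v) = False"

definition binary_value :: "bool list \<Rightarrow> nat" where
  "binary_value = foldl (\<lambda>n b. 2 * n + of_bool b) 0"

lemma binary_value_Nil [simp]: "binary_value [] = 0"
  by (simp add: binary_value_def)

lemma binary_value_Cons [simp]: "binary_value (b # u) = of_bool b * 2 ^ length u + binary_value u"
proof -
  \<comment> \<open>The induction needs an arbitrary accumulator \<open>n\<close>, which every
    further digit doubles.\<close>
  have "foldl (\<lambda>n b. 2 * n + of_bool b) n u = n * 2 ^ length u + binary_value u" for n
  proof (induction u rule: rev_induct)
    case (snoc a u)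
    then show ?case by (simp add: binary_value_def)
  qed simp
  from this[of "of_bool b"] show ?thesis by (simp add: binary_value_def)
qed

lemma binary_value_less: "binary_value u < 2 ^ length u"
  by (induction u) auto

lemma binary_value_digits: "binary_value (digits k) = numeral k"
  by (induction k) (simp_all add: binary_value_def numeral_Bit0 numeral_Bit1)

lemma digits_eq_True_Cons: "\<exists>u. digits k = True # u"
  by (induction k) auto

lemma digits_ge_decided: "length u = length v \<Longrightarrow> digits_ge (Some b) u v = b"
  by (induction u v rule: list_induct2) auto

lemma digits_ge_same_length:
  "length u = length v \<Longrightarrow> digits_ge None u v \<longleftrightarrow> binary_value v \<le> binary_value u"
proof (induction u v rule: list_induct2)
  case (Cons a u b v)
  then show ?case
    using binary_value_less[of u] binary_value_less[of v] by (auto simp: digits_ge_decided)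
qed simp

lemma digits_ge_longer: "length v < length u \<Longrightarrow> digits_ge c u v"
  by (induction c u v rule: digits_ge.induct) auto

lemma digits_ge_shorter: "length u < length v \<Longrightarrow> \<not> digits_ge c u v"
  by (induction c u v rule: digits_ge.induct) auto

text \<open>Numerals have no leading zeros: a leading one makes the value at least
  \<open>2 ^ (length - 1)\<close>, while every value is below \<open>2 ^ length\<close>. So a longer
  numeral is strictly larger.\<close>

lemma length_digits_mono: "l \<le> k \<Longrightarrow> length (digits l) \<le> length (digits k)"
proof (rule ccontr)
  assume "l \<le> k" and less: "\<not> length (digits l) \<le> length (digits k)"
  obtain u where u: "digits l = True # u" using digits_eq_True_Cons by blast
  have "(2::nat) ^ length (digits k) \<le> 2 ^ length u" using less u by (intro power_increasing) auto
  also have "\<dots> \<le> binary_value (digits l)" using u by simp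
  finally have "binary_value (digits k) < binary_value (digits l)"
    using binary_value_less[of "digits k"] by simp
  then show False using \<open>l \<le> k\<close> by (simp add: binary_value_digits)
qed

lemma digits_ge_digits: "digits_ge None (digits k) (digits l) \<longleftrightarrow> l \<le> k"
proof (cases "length (digits k)" "length (digits l)" rule: linorder_cases)
  case less
  then show ?thesis using length_digits_mono[of l k] by (auto simp: digits_ge_shorter)
next
  case equal
  then show ?thesis by (simp add: digits_ge_same_length binary_value_digits)
next
  case greater
  then show ?thesis using length_digits_mono[of k l] digits_ge_longer[of "digits l" "digits k"]
    linear[of k l] by auto
qed

section \<open>Correctness and running time\<close>

context
  fixes F G :: "int \<Rightarrow> letter cell"
begin

text \<open>The counter value is the head position \<open>k\<close> itself; testing for zero means
  checking that the scanned cell is not blank.\<close>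

definition conf :: "control \<Rightarrow> int \<Rightarrow> int \<Rightarrow> int \<Rightarrow> letter config" where
  "conf s i j k = (to_nat s, [(F, i), (G, j), (origin_mark, k)])"

lemma step_conf:
  assumes "s \<notin> {Start, Copy, Accept, Reject}"
  shows "step subsumption_tm (conf s i j k) =
    (case transition s (F i) (G j) (origin_mark k) of
      (s', m0, m1, m2) \<Rightarrow> conf s' (shift m0 i) (shift m1 j) (shift m2 k))"
  using assms by (simp add: conf_def subsumption_tm_def split: prod.split)

lemma reach_SibC:
  assumes "occ G j (word_of C)"
  shows "reach (csize C) (conf SibC i j 0) (conf SibC i (j + int (csize C)) 0)"
  using assms
  by (rule scan_right[of G "conf SibC i", rotated -2])
    (auto intro!: reach_step[simplified] simp: step_conf)

lemma reach_ParC: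
  assumes "occ G (j + 1) (word_of C)"
  shows "reach (csize C) (conf (ParC b) i (j + int (csize C)) 0) (conf (ParC b) i j 0)"
  using assms
  by (rule scan_left[of G "conf (ParC b) i", rotated -2])
    (auto intro!: reach_step[simplified] simp: step_conf)

lemma reach_SibD:
  assumes "occ F i (word_of C)"
  shows "reach (csize C) (conf SibD i j 0) (conf SibD (i + int (csize C)) j 0)"
  using assms
  by (rule scan_right[of F "\<lambda>i. conf SibD i j", rotated -2])
    (auto intro!: reach_step[simplified] simp: step_conf)

lemma reach_ParD:
  assumes "occ F (i + 1) (word_of C)"
  shows "reach (csize C) (conf (ParD b) (i + int (csize C)) j 0) (conf (ParD b) i j 0)"
  using assms
  by (rule scan_left[of F "\<lambda>i. conf (ParD b) i j", rotated -2])
    (auto intro!: reach_step[simplified] simp: step_conf)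

text \<open>Success leaves both heads just behind \<open>LRole\<close>, ready for the role names.
  For failure, bounds on the positions are enough, because \<open>reach_Back\<close> recovers the
  node from anywhere in its header.\<close>

lemma reach_CmpNum:
  assumes "occ G j (map Dig u @ [LRole])" "occ F i (map Dig v @ [LRole])"
  shows "if digits_ge c u v
    then reach (length u + length v + 1) (conf (CmpNum c) i j 0)
      (conf (CmpName True) (i + int (length v) + 1) (j + int (length u) + 1) 0)
    else \<exists>p\<le>length v. \<exists>q\<le>length u. reach (length u + length v + 1) (conf (CmpNum c) i j 0)
      (conf (BackC False) (i + int p) (j + int q) 0)"
  using assms
proof (induction c u v arbitrary: i j rule: digits_ge.induct)
  case (1 c a u b v)
  let ?c = "if c = None \<and> a \<noteq> b then Some a else c"
  have st: "reach 1 (conf (CmpNum c) i j 0) (conf (CmpNum ?c) (i + 1) (j + 1) 0)"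
    using 1 by (intro reach_step) (auto simp: step_conf)
  note IH = 1(1)[of "j + 1" "i + 1"]
  show ?case
  proof (cases "digits_ge ?c u v")
    case True
    with IH 1(2-) have "reach (length u + length v + 1) (conf (CmpNum ?c) (i + 1) (j + 1) 0)
      (conf (CmpName True) (i + 1 + int (length v) + 1) (j + 1 + int (length u) + 1) 0)" by simp
    from reach_trans[OF st this]
    have "reach (length (a # u) + length (b # v) + 1) (conf (CmpNum c) i j 0)
      (conf (CmpName True) (i + int (length (b # v)) + 1) (j + int (length (a # u)) + 1) 0)"
      by (rule reach_cong) (simp_all add: algebra_simps)
    then show ?thesis using True unfolding digits_ge.simps by (simp only: if_True)
  next
    case False
    with IH 1(2-) obtain p q where pq: "p \<le> length v" "q \<le> length u"
      "reach (length u + length v + 1) (conf (CmpNum ?c) (i + 1) (j + 1) 0)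
        (conf (BackC False) (i + 1 + int p) (j + 1 + int q) 0)" by auto
    from reach_trans[OF st pq(3)]
    have "reach (length (a # u) + length (b # v) + 1) (conf (CmpNum c) i j 0)
        (conf (BackC False) (i + int (Suc p)) (j + int (Suc q)) 0)"
      by (rule reach_cong) (simp_all add: algebra_simps)
    moreover have "Suc p \<le> length (b # v)" "Suc q \<le> length (a # u)" using pq by simp_all
    ultimately show ?thesis using False unfolding digits_ge.simps by (simp only: if_False) blast
  qed
next
  case (2 c)
  have "reach 1 (conf (CmpNum c) i j 0)
     (if c \<noteq> Some False then conf (CmpName True) (i + 1) (j + 1) 0 else conf (BackC False) i j 0)"
    using 2 by (intro reach_step) (auto simp: step_conf)
  then show ?case by auto
next
  case (3 c a u)
  \<comment> \<open>The numeral of \<open>C\<close> is longer: the head on \<open>D\<close> waits on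
    \<open>LRole\<close> while the surplus digits are read, and the first of them sets the verdict
    to \<open>Some True\<close>.\<close>
  have "reach (length w) (conf (CmpNum c) i j 0) (conf (CmpNum (Some True)) i (j + int (length w)) 0)"
    if "occ G j (map Dig w)" "w \<noteq> []" for w j c
    using that
  proof (induction w arbitrary: j c)
    case (Cons b w)
    have st: "reach 1 (conf (CmpNum c) i j 0) (conf (CmpNum (Some True)) i (j + 1) 0)"
      using 3 Cons.prems by (intro reach_step) (auto simp: step_conf)
    show ?case
    proof (cases "w = []")
      case True
      then show ?thesis using st by simp
    next
      case False
      then have "reach (length w) (conf (CmpNum (Some True)) i (j + 1) 0)
        (conf (CmpNum (Some True)) i (j + 1 + int (length w)) 0)" using Cons by auto
      from reach_trans[OF st this] show ?thesis by (rule reach_cong) (simp_all add: algebra_simps)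
    qed
  qed simp
  from this[of j "a # u" c] have "reach (length (a # u)) (conf (CmpNum c) i j 0)
      (conf (CmpNum (Some True)) i (j + int (length (a # u))) 0)" using 3 by simp
  also have "reach 1 \<dots> (conf (CmpName True) (i + 1) (j + int (length (a # u)) + 1) 0)"
    using 3 by (intro reach_step) (auto simp: step_conf algebra_simps)
  finally show ?case by simp
next
  case (4 c b v)
  have "reach 1 (conf (CmpNum c) i j 0) (conf (BackC False) (i + int 0) (j + int 0) 0)"
    using 4 by (intro reach_step) (auto simp: step_conf)
  then have "reach (length [] + length (b # v) + 1) (conf (CmpNum c) i j 0)
      (conf (BackC False) (i + int 0) (j + int 0) 0)" by (rule reach_mono) simp
  then show ?case unfolding digits_ge.simps by (simp only: if_False) blast
qed

lemma reach_CmpName_same: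
  assumes "occ F i (map Dig u)" "occ G j (map Dig u)"
  shows "reach (length u) (conf (CmpName g) i j 0)
    (conf (CmpName g) (i + int (length u)) (j + int (length u)) 0)"
  using assms
proof (induction u arbitrary: i j)
  case (Cons a u)
  have "reach 1 (conf (CmpName g) i j 0) (conf (CmpName g) (i + 1) (j + 1) 0)"
    using Cons.prems by (intro reach_step) (auto simp: step_conf is_digit_def)
  also have "reach (length u) \<dots> (conf (CmpName g) (i + 1 + int (length u)) (j + 1 + int (length u)) 0)"
    using Cons.prems by (intro Cons.IH) auto
  finally show ?case by (rule reach_cong) (simp_all add: algebra_simps)
qed (simp add: reach_refl)

text \<open>A name has no end marker, so the letters behind both names must be known not to be
  digits. The mismatch step moves both heads left, hence the \<open>- 1\<close>; with
  \<open>p = 0\<close> the head stands on the letter that introduces the name, still inside the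
  header.\<close>

lemma reach_CmpName_different:
  assumes "occ F i (map Dig v)" "occ G j (map Dig u)"
    and "\<not> is_digit (F (i + int (length v)))" "\<not> is_digit (G (j + int (length u)))"
    and "u \<noteq> v"
  shows "\<exists>p\<le>length v. \<exists>q\<le>length u. reach (length u + 1) (conf (CmpName g) i j 0)
    (conf (BackC False) (i + int p - 1) (j + int q - 1) 0)"
  using assms
proof (induction u arbitrary: i j v)
  case Nil
  then obtain b w where "v = b # w" by (cases v) auto
  then have "F i = Input (Dig b)" "G j \<noteq> Input (Dig b)" using Nil by (auto simp: is_digit_def)
  then have "reach 1 (conf (CmpName g) i j 0) (conf (BackC False) (i + int 0 - 1) (j + int 0 - 1) 0)"
    by (intro reach_step) (auto simp: step_conf is_digit_def)
  then show ?case by auto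
next
  case (Cons a u)
  show ?case
  proof (cases "\<exists>w. v = a # w")
    case True
    then obtain w where v: "v = a # w" by blast
    have st: "reach 1 (conf (CmpName g) i j 0) (conf (CmpName g) (i + 1) (j + 1) 0)"
      using Cons.prems v by (intro reach_step) (auto simp: step_conf is_digit_def)
    have "\<exists>p\<le>length w. \<exists>q\<le>length u. reach (length u + 1) (conf (CmpName g) (i + 1) (j + 1) 0)
      (conf (BackC False) (i + 1 + int p - 1) (j + 1 + int q - 1) 0)"
      using Cons.prems v by (intro Cons.IH) (auto simp: add_ac)
    then obtain p q where pq: "p \<le> length w" "q \<le> length u"
      "reach (length u + 1) (conf (CmpName g) (i + 1) (j + 1) 0)
        (conf (BackC False) (i + 1 + int p - 1) (j + 1 + int q - 1) 0)" by blast
    from reach_trans[OF st pq(3)]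
    have "reach (length (a # u) + 1) (conf (CmpName g) i j 0)
        (conf (BackC False) (i + int (Suc p) - 1) (j + int (Suc q) - 1) 0)"
      by (rule reach_cong) (simp_all add: algebra_simps)
    moreover have "Suc p \<le> length v" "Suc q \<le> length (a # u)" using pq v by simp_all
    ultimately show ?thesis by blast
  next
    case False
    then have "F i \<noteq> G j" using Cons.prems by (cases v) (auto simp: is_digit_def)
    then have "reach 1 (conf (CmpName g) i j 0) (conf (BackC False) (i + int 0 - 1) (j + int 0 - 1) 0)"
      using Cons.prems by (intro reach_step) (auto simp: step_conf is_digit_def)
    then have "reach (length (a # u) + 1) (conf (CmpName g) i j 0)
        (conf (BackC False) (i + int 0 - 1) (j + int 0 - 1) 0)" by (rule reach_mono) simp
    then show ?thesis by blast
  qed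
qed

lemma reach_Back:
  assumes v: "occ F i (a # v)" "a \<in> {LOpen, LConc}" "set v \<inter> {LOpen, LConc} = {}" "p \<le> length v"
    and u: "occ G j (b # u)" "b \<in> {LOpen, LConc}" "set u \<inter> {LOpen, LConc} = {}" "q \<le> length u"
  shows "reach (p + q + 2) (conf (BackC r) (i + int p) (j + int q) 0) (conf (RetC r) i j 0)"
proof -
  have inner: "T (i + int (Suc n)) \<notin> {Input LOpen, Input LConc}"
    if "occ T i (a # v)" "set v \<inter> {LOpen, LConc} = {}" "Suc n \<le> length v" for T i a v n
  proof -
    have "T (i + int (Suc n)) = Input ((a # v) ! Suc n)"
      using that unfolding occ_def by (metis length_Cons less_Suc_eq_le)
    moreover have "(a # v) ! Suc n \<in> set v" using that by simp
    ultimately show ?thesis using that(2) by auto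
  qed
  have C: "reach n (conf (BackC r) i' (j + int n) 0) (conf (BackC r) i' j 0)" if "n \<le> length u" for n i'
    using that
  proof (induction n)
    case (Suc n)
    have "reach 1 (conf (BackC r) i' (j + int (Suc n)) 0) (conf (BackC r) i' (j + int n) 0)"
      using inner[OF u(1,3) Suc.prems] by (intro reach_step) (simp add: step_conf)
    also have "reach n \<dots> (conf (BackC r) i' j 0)" using Suc by simp
    finally show ?case by simp
  qed (simp add: reach_refl)
  have D: "reach n (conf (BackD r) (i + int n) j 0) (conf (BackD r) i j 0)" if "n \<le> length v" for n
    using that
  proof (induction n)
    case (Suc n)
    have "reach 1 (conf (BackD r) (i + int (Suc n)) j 0) (conf (BackD r) (i + int n) j 0)"
      using inner[OF v(1,3) Suc.prems] by (intro reach_step) (simp add: step_conf)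
    also have "reach n \<dots> (conf (BackD r) i j 0)" using Suc by simp
    finally show ?case by simp
  qed (simp add: reach_refl)
  note C[OF u(4)]
  also have "reach 1 (conf (BackC r) (i + int p) j 0) (conf (BackD r) (i + int p) j 0)"
    using u by (intro reach_step) (auto simp: step_conf)
  also note D[OF v(4)]
  also have "reach 1 (conf (BackD r) i j 0) (conf (RetC r) i j 0)"
    using v by (intro reach_step) (auto simp: step_conf)
  finally show ?thesis by (rule reach_mono) simp
qed

section \<open>Visits to pairs of nodes and their cost\<close>

lemma reach_EvalC_Atom:
  assumes "occ F i (word_of (Atom B))" "occ G j (word_of (Atom A))"
    "\<not> is_digit (F (i + int (csize (Atom B))))" "\<not> is_digit (G (j + int (csize (Atom A))))"
  shows "reach (2 * csize (Atom A) + csize (Atom B) + 6) (conf (EvalC False) i j 0) (conf (RetC (A = B)) i j 0)"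
proof -
  have st: "reach 1 (conf (EvalC False) i j 0) (conf (CmpName False) (i + 1) (j + 1) 0)"
    using assms by (intro reach_step) (auto simp: step_conf)
  have o: "occ F (i + 1) (map Dig B)" "occ G (j + 1) (map Dig A)"
    "\<not> is_digit (F (i + 1 + int (length B)))" "\<not> is_digit (G (j + 1 + int (length A)))"
    using assms by (simp_all add: add_ac)
  have "\<exists>p\<le>length B. \<exists>q\<le>length A. reach (length A + 1) (conf (CmpName False) (i + 1) (j + 1) 0)
    (conf (BackC (A = B)) (i + int p) (j + int q) 0)"
  proof (cases "A = B")
    case True
    have "reach (length A) (conf (CmpName False) (i + 1) (j + 1) 0)
      (conf (CmpName False) (i + 1 + int (length A)) (j + 1 + int (length A)) 0)"
      using o True by (intro reach_CmpName_same) auto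
    also have "reach 1 \<dots> (conf (BackC True) (i + int (length A)) (j + int (length A)) 0)"
      using o True by (intro reach_step) (auto simp: step_conf)
    finally show ?thesis
      using True by (intro exI[of _ "length A"] conjI) simp_all
  next
    case False
    from reach_CmpName_different[OF o False] obtain p q where "p \<le> length B" "q \<le> length A"
      "reach (length A + 1) (conf (CmpName False) (i + 1) (j + 1) 0)
        (conf (BackC False) (i + 1 + int p - 1) (j + 1 + int q - 1) 0)" by blast
    then show ?thesis using False by auto
  qed
  then obtain p q where pq: "p \<le> length B" "q \<le> length A"
    and r: "reach (length A + 1) (conf (CmpName False) (i + 1) (j + 1) 0)
      (conf (BackC (A = B)) (i + int p) (j + int q) 0)" by blast
  note st
  also note r
  also have "reach (p + q + 2) (conf (BackC (A = B)) (i + int p) (j + int q) 0) (conf (RetC (A = B)) i j 0)"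
    using assms pq by (intro reach_Back[of _ LConc "map Dig B" _ _ LConc "map Dig A"]) auto
  finally show ?thesis using pq by (elim reach_mono) simp
qed

text \<open>\<open>body\<close> stands for the induction hypothesis on the two bodies, at cost
  \<open>t\<close>. Whether the numbers fail, the names differ or the bodies are evaluated, both
  heads end inside the headers in \<open>BackC\<close> with the correct verdict, and a common return
  to the node starts follows.\<close>

lemma reach_EvalC_AtLeast:
  assumes F: "occ F i (word_of (AtLeast k R D))" and G: "occ G j (word_of (AtLeast l S E))"
    and body: "\<And>i j. occ F i (word_of D) \<Longrightarrow> occ G j (word_of E) \<Longrightarrow>
      \<not> is_digit (F (i + int (csize D))) \<Longrightarrow> \<not> is_digit (G (j + int (csize E))) \<Longrightarrow>
      G (j - 1) = Input LDot \<Longrightarrow> reach t (conf Eval i j 0) (conf (RetD (covers D E)) i j 0)"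
  shows "reach (t + 2 * csize (AtLeast l S E) + 2 * csize (AtLeast k R D) + 20) (conf (EvalC True) i j 0)
    (conf (RetC (covers (AtLeast k R D) (AtLeast l S E))) i j 0)"
proof -
  define v where "v = LGeq # map Dig (digits k) @ [LRole] @ map Dig R @ [LDot]"
  define u where "u = LGeq # map Dig (digits l) @ [LRole] @ map Dig S @ [LDot]"
  define b where "b \<longleftrightarrow> covers (AtLeast k R D) (AtLeast l S E)"
  \<comment> \<open>The first letter of the role name: \<open>LOpen\<close> and \<open>LGeq\<close>
    precede the numeral and \<open>LRole\<close> follows it, hence the offset 3.\<close>
  define i' where "i' = i + 3 + int (length (digits k))"
  define j' where "j' = j + 3 + int (length (digits l))"
  have hdr: "occ F i (LOpen # v)" "occ G j (LOpen # u)"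
    using F G by (simp_all add: u_def v_def)
  have nums: "occ F (i + 2) (map Dig (digits k) @ [LRole])" "occ G (j + 2) (map Dig (digits l) @ [LRole])"
    using F G by (simp_all add: add_ac)
  have names: "occ F i' (map Dig R)" "occ G j' (map Dig S)"
    "F (i' + int (length R)) = Input LDot" "G (j' + int (length S)) = Input LDot"
    using F G by (simp_all add: i'_def j'_def add_ac)
  have bodies: "occ F (i' + int (length R) + 1) (word_of D)" "occ G (j' + int (length S) + 1) (word_of E)"
    "F (i' + int (length R) + 1 + int (csize D)) = Input LClose"
    "G (j' + int (length S) + 1 + int (csize E)) = Input LClose"
    using F G by (simp_all add: i'_def j'_def csize_def add_ac)
  have len: "length v = length (digits k) + length R + 3" "length u = length (digits l) + length S + 3"
    by (simp_all add: u_def v_def)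
  have "reach 1 (conf (EvalC True) i j 0) (conf (EvalCOpen True) i (j + 1) 0)"
    using hdr by (intro reach_step) (auto simp: step_conf)
  also have "reach 1 \<dots> (conf CmpStart (i + 1) (j + 1) 0)"
    using hdr by (intro reach_step) (auto simp: step_conf u_def)
  also have "reach 1 \<dots> (conf (CmpNum None) (i + 2) (j + 2) 0)"
    by (intro reach_step) (simp add: step_conf algebra_simps)
  finally have to_nums: "reach 3 (conf (EvalC True) i j 0) (conf (CmpNum None) (i + 2) (j + 2) 0)"
    by (rule reach_mono) simp
  let ?n = "length (digits l) + length (digits k) + 1"
  have "\<exists>p\<le>length v. \<exists>q\<le>length u. reach (?n + length S + t + 4)
      (conf (CmpNum None) (i + 2) (j + 2) 0) (conf (BackC b) (i + int p) (j + int q) 0)"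
  proof (cases "k \<le> l")
    case False
    with reach_CmpNum[OF nums(2,1), of None] obtain p q where
      pq: "p \<le> length (digits k)" "q \<le> length (digits l)" and
      r: "reach ?n (conf (CmpNum None) (i + 2) (j + 2) 0) (conf (BackC False) (i + 2 + int p) (j + 2 + int q) 0)"
      by (auto simp: digits_ge_digits)
    have "\<not> b" using False by (simp add: b_def)
    show ?thesis
    proof (intro exI conjI)
      show "p + 2 \<le> length v" "q + 2 \<le> length u" using pq len by simp_all
      show "reach (?n + length S + t + 4) (conf (CmpNum None) (i + 2) (j + 2) 0)
          (conf (BackC b) (i + int (p + 2)) (j + int (q + 2)) 0)"
        using r by (rule reach_cong) (use \<open>\<not> b\<close> in \<open>simp_all add: algebra_simps\<close>)
    qed
  next
    case True
    with reach_CmpNum[OF nums(2,1), of None]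
    have "reach ?n (conf (CmpNum None) (i + 2) (j + 2) 0)
        (conf (CmpName True) (i + 2 + int (length (digits k)) + 1) (j + 2 + int (length (digits l)) + 1) 0)"
      by (simp add: digits_ge_digits)
    then have num: "reach ?n (conf (CmpNum None) (i + 2) (j + 2) 0) (conf (CmpName True) i' j' 0)"
      by (rule reach_cong) (simp_all add: i'_def j'_def add_ac)
    show ?thesis
    proof (cases "S = R")
      case False
      have "\<not> is_digit (F (i' + int (length R)))" "\<not> is_digit (G (j' + int (length S)))"
        using names by (simp_all add: is_digit_def)
      from reach_CmpName_different[OF names(1,2) this False] obtain p q where
        pq: "p \<le> length R" "q \<le> length S" and
        r: "reach (length S + 1) (conf (CmpName True) i' j' 0)
          (conf (BackC False) (i' + int p - 1) (j' + int q - 1) 0)" by blast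
      have "\<not> b" using False by (simp add: b_def)
      show ?thesis
      proof (intro exI conjI)
        show "length (digits k) + p + 2 \<le> length v" "length (digits l) + q + 2 \<le> length u"
          using pq len by simp_all
        show "reach (?n + length S + t + 4) (conf (CmpNum None) (i + 2) (j + 2) 0)
          (conf (BackC b) (i + int (length (digits k) + p + 2)) (j + int (length (digits l) + q + 2)) 0)"
          using reach_trans[OF num r]
          by (rule reach_cong) (use \<open>\<not> b\<close> in \<open>simp_all add: i'_def j'_def algebra_simps\<close>)
      qed
    next
      case same: True
      have bE: "b = covers D E" using True same by (simp add: b_def)
      let ?i = "i' + int (length R)" and ?j = "j' + int (length S)"
      note num
      also have "reach (length S) (conf (CmpName True) i' j' 0) (conf (CmpName True) ?i ?j 0)"
        using reach_CmpName_same[of i' S j'] names same by simp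
      also have "reach 1 \<dots> (conf Eval (?i + 1) (?j + 1) 0)"
        using names by (intro reach_step) (auto simp: step_conf is_digit_def)
      also have "reach t \<dots> (conf (RetD b) (?i + 1) (?j + 1) 0)"
        unfolding bE using bodies names by (intro body) (auto simp: is_digit_def)
      also have "reach 1 \<dots> (conf (RetDLeft b) ?i (?j + 1) 0)"
        by (intro reach_step) (auto simp: step_conf)
      also have "reach 1 \<dots> (conf (BackC b) ?i ?j 0)"
        using names by (intro reach_step) (auto simp: step_conf)
      finally have r: "reach (?n + length S + 1 + t + 1 + 1) (conf (CmpNum None) (i + 2) (j + 2) 0)
        (conf (BackC b) ?i ?j 0)" .
      show ?thesis
      proof (intro exI conjI)
        \<comment> \<open>After the bodies have been evaluated both heads stand on
          \<open>LDot\<close>, the last letter of each header.\<close>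
        show "length v \<le> length v" "length u \<le> length u" by simp_all
        show "reach (?n + length S + t + 4) (conf (CmpNum None) (i + 2) (j + 2) 0)
          (conf (BackC b) (i + int (length v)) (j + int (length u)) 0)"
          using r by (rule reach_cong) (simp_all add: len i'_def j'_def algebra_simps)
      qed
    qed
  qed
  then obtain p q where pq: "p \<le> length v" "q \<le> length u" and
    r: "reach (?n + length S + t + 4) (conf (CmpNum None) (i + 2) (j + 2) 0)
      (conf (BackC b) (i + int p) (j + int q) 0)" by blast
  have flat: "set v \<inter> {LOpen, LConc} = {}" "set u \<inter> {LOpen, LConc} = {}" by (auto simp: u_def v_def)
  note to_nums
  also note r
  also have "reach (p + q + 2) (conf (BackC b) (i + int p) (j + int q) 0) (conf (RetC b) i j 0)"
    using hdr flat pq by (intro reach_Back) auto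
  finally show ?thesis
    unfolding b_def[symmetric] by (rule reach_mono) (use pq len in simp)
qed

text \<open>The node \<open>d\<close> stays fixed while the conjuncts of \<open>c\<close> are tried
  from left to right, stopping at the first success; \<open>covers\<close> says that this
  disjunction is right for \<open>d\<close>. \<open>base\<close> treats the leaves of the
  conjunction tree. The factor \<open>e\<close> is the share of the cost due to \<open>d\<close>,
  and \<open>K\<close> absorbs the linear overhead of moving between conjuncts.\<close>

lemma reach_EvalC:
  assumes eval: "\<And>j. reach 2 (conf Eval i j 0) (conf (EvalC g) i j 0)"
    and base: "\<And>c j. \<nexists>c1 c2. c = And c1 c2 \<Longrightarrow> occ G j (word_of c) \<Longrightarrow>
      \<not> is_digit (G (j + int (csize c))) \<Longrightarrow> 4 * csize c + 20 \<le> K \<Longrightarrow>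
      reach (K * e * csize c) (conf (EvalC g) i j 0) (conf (RetC (covers d c)) i j 0)"
    and covers: "\<And>c1 c2. covers d (And c1 c2) \<longleftrightarrow> covers d c1 \<or> covers d c2"
    and e: "e \<ge> 1"
  shows "occ G j (word_of c) \<Longrightarrow> \<not> is_digit (G (j + int (csize c))) \<Longrightarrow> 4 * csize c + 20 \<le> K \<Longrightarrow>
    reach (K * e * csize c) (conf (EvalC g) i j 0) (conf (RetC (covers d c)) i j 0)"
proof (induction c arbitrary: j)
  case (And c1 c2)
  define j2 where "j2 = j + 1 + int (csize c1)"
  have o: "G j = Input LOpen" "occ G (j + 1) (word_of c1)" "G j2 = Input LAnd"
    "occ G (j2 + 1) (word_of c2)" "G (j2 + 1 + int (csize c2)) = Input LClose"
    using And.prems by (simp_all add: j2_def csize_def)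
  have K: "4 * csize c1 + 20 \<le> K" "4 * csize c2 + 20 \<le> K" "2 * csize c1 + 20 \<le> K"
    using And.prems(3) by simp_all
  \<comment> \<open>The three symbols that a conjunction adds contribute \<open>3 * K * e\<close> to
    the budget, more than the overhead \<open>K\<close>.\<close>
  have bound: "K * e * csize c1 + K * e * csize c2 + K \<le> K * e * csize (And c1 c2)"
  proof -
    have "K \<le> K * e" using e by simp
    also have "\<dots> \<le> K * e * 3" by simp
    finally show ?thesis by (simp add: distrib_left)
  qed
  have "G (j + 1) \<noteq> Input LGeq" using occ_word_of_hd[OF o(2)] by auto
  have "reach 1 (conf (EvalC g) i j 0) (conf (EvalCOpen g) i (j + 1) 0)"
    using o by (intro reach_step) (auto simp: step_conf)
  also have "reach 1 \<dots> (conf (EvalC g) i (j + 1) 0)"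
    using \<open>G (j + 1) \<noteq> Input LGeq\<close> by (intro reach_step) (auto simp: step_conf)
  also have "reach (K * e * csize c1) \<dots> (conf (RetC (covers d c1)) i (j + 1) 0)"
    using o K And.prems by (intro And.IH) (auto simp: is_digit_def j2_def)
  also have "reach 1 \<dots> (conf (RetCLeft (covers d c1)) i j 0)"
    by (intro reach_step) (auto simp: step_conf)
  finally have left: "reach (1 + 1 + K * e * csize c1 + 1) (conf (EvalC g) i j 0)
    (conf (RetCLeft (covers d c1)) i j 0)" .
  show ?case
  proof (cases "covers d c1")
    case True
    note left
    also have "reach 1 (conf (RetCLeft (covers d c1)) i j 0) (conf (RetC True) i j 0)"
      using o True by (intro reach_step) (auto simp: step_conf)
    finally show ?thesis
    proof (rule reach_cong)
      show "1 + 1 + K * e * csize c1 + 1 + 1 \<le> K * e * csize (And c1 c2)" using bound K by linarith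
    qed (simp_all add: covers True)
  next
    case False
    let ?b = "covers d c2"
    note left
    also have "reach 1 (conf (RetCLeft (covers d c1)) i j 0) (conf SibC i (j + 1) 0)"
      using o False by (intro reach_step) (auto simp: step_conf)
    also have "reach (csize c1) \<dots> (conf SibC i j2 0)"
      using reach_SibC[OF o(2)] by (simp add: j2_def)
    also have "reach 1 \<dots> (conf Eval i (j2 + 1) 0)"
      using o by (intro reach_step) (auto simp: step_conf)
    \<comment> \<open>\<open>SibC\<close> does not carry \<open>g\<close>, so the sibling is entered
      through \<open>Eval\<close>, which reads the kind of \<open>d\<close> again.\<close>
    also note eval
    also have "reach (K * e * csize c2) (conf (EvalC g) i (j2 + 1) 0) (conf (RetC ?b) i (j2 + 1) 0)"
      using o K And.prems by (intro And.IH) (auto simp: is_digit_def)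
    also have "reach 1 \<dots> (conf (RetCLeft ?b) i j2 0)"
      by (intro reach_step) (auto simp: step_conf)
    \<comment> \<open>The right conjunct is tried only after the left one failed, so its result is
      already that of the parent.\<close>
    also have "reach 1 \<dots> (conf (ParC ?b) i (j + int (csize c1)) 0)"
      using o by (intro reach_step) (auto simp: step_conf j2_def)
    also note reach_ParC[OF o(2)]
    also have "reach 1 (conf (ParC ?b) i j 0) (conf (RetC ?b) i j 0)"
      using o by (intro reach_step) (auto simp: step_conf)
    finally show ?thesis
    proof (rule reach_cong)
      show "1 + 1 + K * e * csize c1 + 1 + 1 + csize c1 + 1 + 2 + K * e * csize c2 + 1 + 1 + csize c1 + 1
          \<le> K * e * csize (And c1 c2)"
        using bound K by linarith
    qed (simp_all add: covers False)
  qed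
next
  case (Atom A)
  show ?case by (rule base[OF _ Atom.prems]) simp
next
  case Top
  show ?case by (rule base[OF _ Top.prems]) simp
next
  case (AtLeast k R c)
  show ?case by (rule base[OF _ AtLeast.prems]) simp
qed

lemma reach_RetC_RetD:
  assumes "G (j - 1) \<notin> {Input LOpen, Input LAnd}"
  shows "reach 2 (conf (RetC b) i j 0) (conf (RetD b) i j 0)"
proof -
  have "reach 1 (conf (RetC b) i j 0) (conf (RetCLeft b) i (j - 1) 0)"
    by (intro reach_step) (auto simp: step_conf)
  also have "reach 1 \<dots> (conf (RetD b) i j 0)"
    using assms by (intro reach_step) (auto simp: step_conf)
  finally show ?thesis by (simp add: numeral_2_eq_2)
qed

text \<open>Induction on \<open>d\<close>: conjunctions of \<open>d\<close> are evaluated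
  conjunctively, and at every other node than \<open>Top\<close> the search through \<open>c\<close>
  is \<open>reach_EvalC\<close>. The condition on \<open>G (j - 1)\<close> says that
  \<open>c\<close> is a whole concept or a restriction body, not a conjunct, so \<open>RetC\<close>
  hands over to \<open>RetD\<close>. The product bound reflects that each pair of nodes is visited
  at most once, with linear overhead \<open>K\<close>.\<close>

lemma reach_Eval:
  "occ F i (word_of d) \<Longrightarrow> occ G j (word_of c) \<Longrightarrow>
   \<not> is_digit (F (i + int (csize d))) \<Longrightarrow> \<not> is_digit (G (j + int (csize c))) \<Longrightarrow>
   G (j - 1) \<notin> {Input LOpen, Input LAnd} \<Longrightarrow> 4 * csize c + 20 \<le> K \<Longrightarrow> 4 * csize d + 20 \<le> K \<Longrightarrow>
   reach (K * (2 * csize d) * csize c) (conf Eval i j 0) (conf (RetD (covers d c)) i j 0)"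
proof (induction d arbitrary: i j c)
  case (Atom A)
  have eval: "reach 1 (conf Eval i j 0) (conf (EvalC False) i j 0)" for j
    using Atom.prems by (intro reach_step) (auto simp: step_conf)
  have main: "reach (K * 1 * csize c) (conf (EvalC False) i j 0) (conf (RetC (covers (Atom A) c)) i j 0)"
  proof (rule reach_EvalC)
    show "reach 2 (conf Eval i j 0) (conf (EvalC False) i j 0)" for j
      using eval by (rule reach_mono) simp
  next
    fix c j assume c: "\<nexists>c1 c2. c = And c1 c2" "occ G j (word_of c)"
      "\<not> is_digit (G (j + int (csize c)))" "4 * csize c + 20 \<le> K"
    have K: "2 * csize c + 2 * csize (Atom A) + 20 \<le> K * 1 * csize c"
    proof -
      have "2 * csize c + 2 * csize (Atom A) + 20 \<le> K" using c(4) Atom.prems(7) by simp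
      also have "\<dots> \<le> K * 1 * csize c" using c(1) by (cases c) simp_all
      finally show ?thesis .
    qed
    show "reach (K * 1 * csize c) (conf (EvalC False) i j 0) (conf (RetC (covers (Atom A) c)) i j 0)"
    proof (cases c)
      case (Atom B)
      have "reach (2 * csize (Atom B) + csize (Atom A) + 6) (conf (EvalC False) i j 0)
          (conf (RetC (B = A)) i j 0)"
        using c Atom.prems Atom by (intro reach_EvalC_Atom) auto
      then show ?thesis by (rule reach_cong) (use K Atom in \<open>auto simp: eq_commute[of B A]\<close>)
    next
      case Top
      have "reach 1 (conf (EvalC False) i j 0) (conf (RetC False) i j 0)"
        using c Top by (intro reach_step) (auto simp: step_conf)
      then show ?thesis by (rule reach_cong) (use K Top in auto)
    next
      case (And c1 c2)
      then show ?thesis using c by blast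
    next
      case (AtLeast l S E)
      have "reach 1 (conf (EvalC False) i j 0) (conf (EvalCOpen False) i (j + 1) 0)"
        using c AtLeast by (intro reach_step) (auto simp: step_conf)
      also have "reach 1 \<dots> (conf (RetC False) i j 0)"
        using c AtLeast by (intro reach_step) (auto simp: step_conf)
      finally show ?thesis by (rule reach_cong) (use K AtLeast in auto)
    qed
  qed (use Atom.prems in auto)
  note eval also note main
  also note reach_RetC_RetD[OF Atom.prems(5)]
  finally show ?case
  proof (rule reach_mono)
    have "K \<le> K * csize c" by (cases c) auto
    then have "3 \<le> K * csize c" using Atom.prems(6) by linarith
    then have "1 + K * 1 * csize c + 2 \<le> K * 2 * csize c" by simp
    also have "\<dots> \<le> K * (2 * csize (Atom A)) * csize c" by (intro mult_le_mono) auto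
    finally show "1 + K * 1 * csize c + 2 \<le> K * (2 * csize (Atom A)) * csize c" .
  qed
next
  case Top
  have "reach 1 (conf Eval i j 0) (conf (RetC True) i j 0)"
    using Top.prems by (intro reach_step) (auto simp: step_conf)
  also note reach_RetC_RetD[OF Top.prems(5)]
  finally show ?case
  proof (rule reach_cong)
    have "K \<le> K * csize c" by (cases c) auto
    then have "3 \<le> K * csize c" using Top.prems(6) by linarith
    then show "1 + 2 \<le> K * (2 * csize Top) * csize c" by simp
  qed simp_all
next
  case (And d1 d2)
  define i2 where "i2 = i + 1 + int (csize d1)"
  have o: "F i = Input LOpen" "occ F (i + 1) (word_of d1)" "F i2 = Input LAnd"
    "occ F (i2 + 1) (word_of d2)" "F (i2 + 1 + int (csize d2)) = Input LClose"
    using And.prems by (simp_all add: i2_def csize_def)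
  have K: "4 * csize d1 + 20 \<le> K" "4 * csize d2 + 20 \<le> K" "2 * csize d1 + 20 \<le> K"
    using And.prems(7) by simp_all
  let ?T = "\<lambda>d. K * (2 * csize d) * csize c"
  have bound: "?T d1 + ?T d2 + K \<le> ?T (And d1 d2)"
  proof -
    have "K \<le> K * csize c" by (cases c) auto
    then show ?thesis by (simp add: algebra_simps)
  qed
  have nG: "F (i + 1) \<noteq> Input LGeq" using occ_word_of_hd[OF o(2)] by auto
  have "reach 1 (conf Eval i j 0) (conf EvalOpen (i + 1) j 0)"
    using o by (intro reach_step) (auto simp: step_conf)
  also have "reach 1 \<dots> (conf Eval (i + 1) j 0)"
    using nG by (intro reach_step) (auto simp: step_conf)
  also have "reach (?T d1) \<dots> (conf (RetD (covers d1 c)) (i + 1) j 0)"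
    using o K And.prems by (intro And.IH) (auto simp: is_digit_def i2_def)
  also have "reach 1 \<dots> (conf (RetDLeft (covers d1 c)) i j 0)"
    by (intro reach_step) (auto simp: step_conf)
  finally have left: "reach (1 + 1 + ?T d1 + 1) (conf Eval i j 0) (conf (RetDLeft (covers d1 c)) i j 0)" .
  show ?case
  proof (cases "covers d1 c")
    case False
    note left
    also have "reach 1 (conf (RetDLeft (covers d1 c)) i j 0) (conf (RetD False) i j 0)"
      using o False by (intro reach_step) (auto simp: step_conf)
    finally show ?thesis
    proof (rule reach_cong)
      show "1 + 1 + ?T d1 + 1 + 1 \<le> ?T (And d1 d2)" using bound K by linarith
    qed (simp_all add: False)
  next
    case True
    let ?b = "covers d2 c"
    note left
    also have "reach 1 (conf (RetDLeft (covers d1 c)) i j 0) (conf SibD (i + 1) j 0)"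
      using o True by (intro reach_step) (auto simp: step_conf)
    also have "reach (csize d1) \<dots> (conf SibD i2 j 0)"
      using reach_SibD[OF o(2)] by (simp add: i2_def)
    also have "reach 1 \<dots> (conf Eval (i2 + 1) j 0)"
      using o by (intro reach_step) (auto simp: step_conf)
    also have "reach (?T d2) \<dots> (conf (RetD ?b) (i2 + 1) j 0)"
      using o K And.prems by (intro And.IH) (auto simp: is_digit_def)
    also have "reach 1 \<dots> (conf (RetDLeft ?b) i2 j 0)"
      by (intro reach_step) (auto simp: step_conf)
    also have "reach 1 \<dots> (conf (ParD ?b) (i + int (csize d1)) j 0)"
      using o by (intro reach_step) (auto simp: step_conf i2_def)
    also note reach_ParD[OF o(2)]
    also have "reach 1 (conf (ParD ?b) i j 0) (conf (RetD ?b) i j 0)"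
      using o by (intro reach_step) (auto simp: step_conf)
    finally show ?thesis
    proof (rule reach_cong)
      show "1 + 1 + ?T d1 + 1 + 1 + csize d1 + 1 + ?T d2 + 1 + 1 + csize d1 + 1 \<le> ?T (And d1 d2)"
        using bound K by linarith
    qed (simp_all add: True)
  qed
next
  case (AtLeast k R D)
  \<comment> \<open>\<open>?e + 1\<close> is at most \<open>2 * csize ?d\<close>; that gap of
    \<open>K * csize c\<close> later pays for entering through \<open>Eval\<close> and leaving
    through \<open>RetD\<close>.\<close>
  let ?d = "AtLeast k R D" let ?e = "2 * csize D + 1"
  have eval: "reach 2 (conf Eval i j 0) (conf (EvalC True) i j 0)" for j
  proof -
    have "reach 1 (conf Eval i j 0) (conf EvalOpen (i + 1) j 0)"
      using AtLeast.prems by (intro reach_step) (auto simp: step_conf)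
    also have "reach 1 \<dots> (conf (EvalC True) i j 0)"
      using AtLeast.prems by (intro reach_step) (auto simp: step_conf)
    finally show ?thesis by (simp add: numeral_2_eq_2)
  qed
  have main: "reach (K * ?e * csize c) (conf (EvalC True) i j 0) (conf (RetC (covers ?d c)) i j 0)"
  proof (rule reach_EvalC[OF eval])
    fix c j assume c: "\<nexists>c1 c2. c = And c1 c2" "occ G j (word_of c)"
      "\<not> is_digit (G (j + int (csize c)))" "4 * csize c + 20 \<le> K"
    have K: "2 * csize c + 2 * csize ?d + 20 \<le> K" using c(4) AtLeast.prems(7) by simp
    have "K * 1 * 1 \<le> K * ?e * csize c" by (intro mult_le_mono) (cases c; simp)+
    then have K': "K \<le> K * ?e * csize c" by simp
    show "reach (K * ?e * csize c) (conf (EvalC True) i j 0) (conf (RetC (covers ?d c)) i j 0)"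
    proof (cases c)
      case (Atom B)
      have "reach 1 (conf (EvalC True) i j 0) (conf (RetC False) i j 0)"
        using c Atom by (intro reach_step) (auto simp: step_conf)
      moreover have "1 \<le> K * ?e * csize c" using K K' by linarith
      ultimately show ?thesis using Atom by (auto intro: reach_mono)
    next
      case Top
      have "reach 1 (conf (EvalC True) i j 0) (conf (RetC False) i j 0)"
        using c Top by (intro reach_step) (auto simp: step_conf)
      moreover have "1 \<le> K * ?e * csize c" using K K' by linarith
      ultimately show ?thesis using Top by (auto intro: reach_mono)
    next
      case (And c1 c2)
      then show ?thesis using c by blast
    next
      case c': (AtLeast l S E)
      let ?t = "K * (2 * csize D) * csize E"
      have "reach (?t + 2 * csize (AtLeast l S E) + 2 * csize ?d + 20) (conf (EvalC True) i j 0)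
          (conf (RetC (covers ?d (AtLeast l S E))) i j 0)"
      proof (rule reach_EvalC_AtLeast)
        show "occ F i (word_of ?d)" "occ G j (word_of (AtLeast l S E))"
          using AtLeast.prems(1) c(2) c' by simp_all
      next
        fix i j assume "occ F i (word_of D)" "occ G j (word_of E)"
          "\<not> is_digit (F (i + int (csize D)))" "\<not> is_digit (G (j + int (csize E)))"
          "G (j - 1) = Input LDot"
        then show "reach ?t (conf Eval i j 0) (conf (RetD (covers D E)) i j 0)"
          using c c' AtLeast.prems(7) by (intro AtLeast.IH) auto
      qed
      then show ?thesis unfolding c'
      proof (rule reach_mono)
        \<comment> \<open>The header comparison costs at most \<open>K\<close>, which fits because
          the restriction on the \<open>C\<close> side is longer than its body
          \<open>E\<close>.\<close>
        have "?t + 2 * csize (AtLeast l S E) + 2 * csize ?d + 20 \<le> ?t + K" using K c' by simp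
        also have "\<dots> \<le> K * ?e * csize E + K * ?e * 1"
          by (intro add_mono mult_le_mono) simp_all
        also have "\<dots> = K * ?e * (csize E + 1)" by (simp add: distrib_left)
        also have "\<dots> \<le> K * ?e * csize (AtLeast l S E)" by (intro mult_le_mono) simp_all
        finally show "?t + 2 * csize (AtLeast l S E) + 2 * csize ?d + 20 \<le> K * ?e * csize (AtLeast l S E)" .
      qed
    qed
  qed (use AtLeast.prems in auto)
  note eval also note main
  also note reach_RetC_RetD[OF AtLeast.prems(5)]
  finally show ?case
  proof (rule reach_mono)
    have "K \<le> K * csize c" by (cases c) auto
    then have "4 \<le> K * csize c" using AtLeast.prems(6) by linarith
    then have "2 + K * ?e * csize c + 2 \<le> K * (?e + 1) * csize c" by (simp add: algebra_simps)
    also have "\<dots> \<le> K * (2 * csize ?d) * csize c" by (intro mult_le_mono) auto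
    finally show "2 + K * ?e * csize c + 2 \<le> K * (2 * csize ?d) * csize c" .
  qed
qed

end

section \<open>Initialisation and total running time\<close>

lemma occ_input_tape: "occ (fst (input_tape w)) 0 w"
  by (simp add: occ_def input_tape_def)

lemma input_tape_snoc: "(fst (input_tape u))(int (length u) := Input a) = fst (input_tape (u @ [a]))"
  by (auto simp: input_tape_def fun_eq_iff nth_append)

lemma LSub_notin_word_of: "LSub \<notin> set (word_of C)"
  by (induction C) auto

lemma step_Copy:
  "F i = Input a \<Longrightarrow> a \<noteq> LSub \<Longrightarrow>
    step subsumption_tm (conf F G Copy i j k) = conf F (G(j := Input a)) Copy (i + 1) (j + 1) k"
  "F i = Input LSub \<Longrightarrow>
    step subsumption_tm (conf F G Copy i j k) = conf F G Rewind (i + 1) (j - 1) k"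
  by (simp_all add: conf_def subsumption_tm_def fun_upd_idem)

lemma reach_Copy:
  assumes "occ F 0 u" "LSub \<notin> set u"
  shows "reach (length u) (conf F (fst (input_tape [])) Copy 0 0 0)
    (conf F (fst (input_tape u)) Copy (int (length u)) (int (length u)) 0)"
  using assms
proof (induction u rule: rev_induct)
  case (snoc a u)
  have "reach (length u) (conf F (fst (input_tape [])) Copy 0 0 0)
    (conf F (fst (input_tape u)) Copy (int (length u)) (int (length u)) 0)" using snoc by simp
  also have "reach 1 \<dots> (conf F (fst (input_tape (u @ [a]))) Copy (int (length (u @ [a]))) (int (length (u @ [a]))) 0)"
    using snoc.prems by (intro reach_step) (auto simp: step_Copy(1)[of _ _ a] input_tape_snoc add.commute)
  finally show ?case by simp
qed (simp add: reach_refl)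

lemma reach_Rewind:
  "n \<le> length u \<Longrightarrow>
    reach (n + 1) (conf F (fst (input_tape u)) Rewind i (int n - 1) 0) (conf F (fst (input_tape u)) Eval i 0 0)"
proof (induction n)
  case 0
  have "reach 1 (conf F (fst (input_tape u)) Rewind i (int 0 - 1) 0) (conf F (fst (input_tape u)) Eval i 0 0)"
    by (intro reach_step) (simp add: step_conf input_tape_def)
  then show ?case by simp
next
  case (Suc n)
  have "reach 1 (conf F (fst (input_tape u)) Rewind i (int (Suc n) - 1) 0)
      (conf F (fst (input_tape u)) Rewind i (int n - 1) 0)"
    using Suc.prems by (intro reach_step) (simp add: step_conf input_tape_def)
  also have "reach (n + 1) \<dots> (conf F (fst (input_tape u)) Eval i 0 0)" using Suc by simp
  finally show ?case by simp
qed

text \<open>Copying \<open>C\<close>, rewinding the copy and the start and end steps account for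
  \<open>5 + 2 * csize C\<close>; the rest is one call of \<open>reach_Eval\<close> at the two
  roots. \<open>K\<close> is chosen to dominate the linear bounds for both concepts.\<close>

lemma subsumption_tm_decides:
  defines "K \<equiv> \<lambda>C D. 4 * (csize C + csize D) + 20"
  shows "\<exists>c. reach (5 + 2 * csize C + K C D * (2 * csize D) * csize C)
    (initial subsumption_tm (input_word C D)) c \<and>
    fst c = (if covers D C then accept subsumption_tm else reject subsumption_tm)"
proof -
  define F where "F = fst (input_tape (input_word C D))"
  define G where "G = fst (input_tape (word_of C))"
  define n where "n = int (csize C)"
  have F: "occ F 0 (word_of C)" "F n = Input LSub" "occ F (n + 1) (word_of D)"
    using occ_input_tape[of "input_word C D"] by (simp_all add: F_def n_def input_word_def csize_def)
  have F_end: "F (n + 1 + int (csize D)) = Blank"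
    by (simp add: F_def n_def input_tape_def input_word_def csize_def)
  have G: "occ G 0 (word_of C)" unfolding G_def by (rule occ_input_tape)
  have G_ends: "G (0 + int (csize C)) = Blank" "G (0 - 1) = Blank"
    by (simp_all add: G_def input_tape_def csize_def)
  let ?b = "covers D C"
  have "reach 1 (initial subsumption_tm (input_word C D)) (conf F (fst (input_tape [])) Copy 0 0 0)"
  proof (rule reach_step)
    have "input_tape (input_word C D) = (F, 0)" "input_tape [] = ((\<lambda>_. Blank) :: int \<Rightarrow> letter cell, 0)"
      by (auto simp: F_def input_tape_def)
    then show "step subsumption_tm (initial subsumption_tm (input_word C D)) =
        conf F (fst (input_tape [])) Copy 0 0 0"
      by (simp add: initial_def subsumption_tm_def conf_def numeral_2_eq_2 origin_mark_def fun_upd_idem)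
  qed
  also have "reach (csize C) \<dots> (conf F G Copy n n 0)"
    using reach_Copy[OF F(1) LSub_notin_word_of] by (simp add: csize_def n_def G_def)
  also have "reach 1 \<dots> (conf F G Rewind (n + 1) (n - 1) 0)"
    using F(2) by (intro reach_step) (simp add: step_Copy)
  also have "reach (csize C + 1) \<dots> (conf F G Eval (n + 1) 0 0)"
    unfolding n_def G_def by (rule reach_Rewind) (simp add: csize_def)
  also have "reach (K C D * (2 * csize D) * csize C) \<dots> (conf F G (RetD ?b) (n + 1) 0 0)"
    using F F_end G G_ends by (intro reach_Eval) (simp_all add: is_digit_def K_def)
  also have "reach 1 \<dots> (conf F G (RetDLeft ?b) n 0 0)"
    by (intro reach_step) (simp add: step_conf)
  \<comment> \<open>\<open>D\<close> is preceded by \<open>LSub\<close>, which identifies its root,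
    so the verdict becomes final.\<close>
  also have "reach 1 \<dots> (conf F G (if ?b then Accept else Reject) n 0 0)"
    using F(2) by (intro reach_step) (simp add: step_conf)
  finally have "reach (5 + 2 * csize C + K C D * (2 * csize D) * csize C)
      (initial subsumption_tm (input_word C D)) (conf F G (if ?b then Accept else Reject) n 0 0)"
    by (rule reach_mono) simp
  then show ?thesis
    by (intro exI conjI) (assumption, simp add: conf_def subsumption_tm_def)
qed

theorem theorem8:
  "\<exists>(M :: letter tm) (p :: nat poly). turing_machine M \<and>
     (\<forall>C C'.
        (subsumed C C' \<longrightarrow> accepts_within M (input_word C C') (poly p (csize C + csize C'))) \<and>
        (\<not> subsumed C C' \<longrightarrow> rejects_within M (input_word C C') (poly p (csize C + csize C'))))"
proof (intro exI conjI allI)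
  show "turing_machine subsumption_tm" by (rule turing_machine_subsumption_tm)
next
  fix C C'
  \<comment> \<open>The coefficients are those of \<open>5 + 2n + (4n + 20)(2n)n\<close>, the bound
    with both sizes replaced by their sum.\<close>
  let ?n = "csize C + csize C'" and ?p = "[:5, 2, 40, 8:] :: nat poly"
  obtain c where
    c: "reach (5 + 2 * csize C + (4 * ?n + 20) * (2 * csize C') * csize C)
      (initial subsumption_tm (input_word C C')) c"
    and verdict: "fst c = (if covers C' C then accept subsumption_tm else reject subsumption_tm)"
    using subsumption_tm_decides by blast
  have "5 + 2 * csize C + (4 * ?n + 20) * (2 * csize C') * csize C
      \<le> 5 + 2 * ?n + (4 * ?n + 20) * (2 * ?n) * ?n"
    by (intro add_mono mult_le_mono) simp_all
  also have "\<dots> = poly ?p ?n" by (simp add: algebra_simps)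
  finally have "reach (poly ?p ?n) (initial subsumption_tm (input_word C C')) c"
    by (rule reach_mono[OF c])
  then obtain t where "t \<le> poly ?p ?n" "(step subsumption_tm ^^ t) (initial subsumption_tm (input_word C C')) = c"
    unfolding reach_def by blast
  then show "subsumed C C' \<longrightarrow> accepts_within subsumption_tm (input_word C C') (poly ?p ?n)"
    and "\<not> subsumed C C' \<longrightarrow> rejects_within subsumption_tm (input_word C C') (poly ?p ?n)"
    unfolding accepts_within_def rejects_within_def subsumed_iff_covers using verdict by auto
qed

end
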